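(* Let $M$ be a connected compact oriented surface distinct from the 2-sphere $S^2$ and the 2-torus $T^2$, let $f$ be a Morse function on $M$ (with values in $P=\mathbb{R}$ or $P=S^1$), let $G=\pi_1\mathcal{O}_f(f)\in\mathcal{G}$, let $\omega$ be an arbitrary presentation of $G$ in the alphabet $\mathcal{A}$, and let $\beta_1(\omega)$ be the number of symbols $\mathbb{Z}$ in the presentation $\omega$. Then the first integral homology group $H_1(\mathcal{O}(f),\mathbb{Z})$ of $\mathcal{O}(f)$ is a free abelian group of rank $\beta_1(\omega)$: $$H_1(\mathcal{O}(f),\mathbb{Z})\simeq\mathbb{Z}^{\beta_1(\omega)}.$$ In particular, $\beta_1(\omega)$ is the first Betti number of $\mathcal{O}(f)$.
   Context: Let $M$ be a compact surface, $\mathcal{D}(M)$ the group of $C^\infty$-diffeomorphisms of $M$, and $P$ either the real line $\mathbb{R}$ or the circle $S^1$. The group $\mathcal{D}(M)$ acts on $C^\infty(M,P)$ on the right by $(f,h)\mapsto f\circ h$. The orbit of $f$ is $\mathcal{O}(f)=\{f\circ h : h\in\mathcal{D}(M)\}$. The spaces $\mathcal{D}(M)$ and $C^\infty(M,P)$ carry the Whitney $C^\infty$-topologies, and $\mathcal{O}_f(f)$ denotes the path component of $f$ in $\mathcal{O}(f)$. A map $f\in C^\infty(M,P)$ is called Morse if all its critical points are non-degenerate. For a group $A$ and an integer $n\ge 1$, the wreath product $A\wr_n\mathbb{Z}$ is the semidirect product $A^n\rtimes_\varphi\mathbb{Z}$, where $\varphi\colon\mathbb{Z}\to\operatorname{Aut}(A^n)$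 is the action by cyclic shifts of coordinates: $\varphi(k)(a_0,\dots,a_{n-1})=(a_{k \bmod n},a_{(1+k)\bmod n},\dots,a_{(n-1+k) \bmod n})$. In particular $A\wr_1\mathbb{Z}=A\times\mathbb{Z}$ and $1\wr_n\mathbb{Z}=\mathbb{Z}$. $\mathcal{G}$ is the minimal class of groups (considered up to isomorphism) such that: (1) the trivial group $1$ belongs to $\mathcal{G}$; (2) if $A,B\in\mathcal{G}$ then $A\times B\in\mathcal{G}$; (3) if $A\in\mathcal{G}$ and $n\ge 1$ then $A\wr_n\mathbb{Z}\in\mathcal{G}$. A presentation of $G\in\mathcal{G}$ in the alphabet $\mathcal{A}=\{1,\mathbb{Z},(,),\times,\wr_2,\wr_3,\wr_4,\dots\}$ is a word in this alphabet, i.e. an expression built from the symbols $1$ and $\mathbb{Z}$ by finitely many operations $(\alpha,\beta)\mapsto \alpha\times\beta$ and $\alpha\mapsto\alpha\wr_n\mathbb{Z}$ ($n\ge2$), with brackets where needed, such that the group it determines is isomorphic to $G$. The number $\beta_1(\omega)$ counts all occurrences of the symbol $\mathbb{Z}$ in the word, including those occurring in $\wr_n\mathbb{Z}$; so $\beta_1(1)=0$, $\beta_1(\mathbb{Z})=1$, $\beta_1(\alpha\times\beta)=\beta_1(\alpha)+\beta_1(\beta)$, $\beta_1(\alpha\wr_n\mathbb{Z})=\beta_1(\alpha)+1$. The membership of the fundamental group of the orbit in $\mathcal{G}$ for such $M$ and $f$ is taken as a known consequence of results of S. Maksymenko (Homotopy types of right stabilizers and orbits of smooth functions on surfaces, Ukrainian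 Math. J. 64 (2012)).
   Formalization: H_1 and the first Betti number are taken for the path component O_f(f) rather than the whole orbit O(f); for a disconnected orbit H_1(O(f)) is a direct sum over its homeomorphic components, so the claim as written fails when β_1(ω) ≥ 1. *)

theory Defs
  imports
    "HOL-Analysis.Analysis"
    "HOL-Homology.Homology"
    "HOL-Algebra.Product_Groups"
    "HOL-Algebra.Weak_Morphisms"
    "HOL-Library.Extended_Nat"
begin

section \<open>Smooth surfaces with boundary\<close>

text \<open>
  Derivatives are taken within the domain, so they are one-sided at points on the
  boundary of a half-plane.  Only sets \<open>S\<close> that are relatively open in the closed
  half-plane occur below; on these the derivative within \<open>S\<close> is unique.
  \<open>iter_deriv S [v1, ..., vk] g\<close> is the iterated directional derivative of \<open>g\<close>.
\<close>

primrec iter_deriv ::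
  "'a::euclidean_space set \<Rightarrow> 'a list \<Rightarrow> ('a \<Rightarrow> 'b::real_normed_vector) \<Rightarrow> 'a \<Rightarrow> 'b" where
  "iter_deriv S [] g = g"
| "iter_deriv S (v # vs) g = (\<lambda>x. frechet_derivative (iter_deriv S vs g) (at x within S) v)"

definition smooth_on :: "'a::euclidean_space set \<Rightarrow> ('a \<Rightarrow> 'b::real_normed_vector) \<Rightarrow> bool" where
  "smooth_on S g \<longleftrightarrow> (\<forall>vs. set vs \<subseteq> Basis \<longrightarrow> iter_deriv S vs g differentiable_on S)"

definition half_plane :: "(real^2) set" where
  "half_plane = {x. x $ 2 \<ge> 0}"

text \<open>A chart is a pair of a domain and a coordinate map (irrelevant outside the domain).\<close>

type_synonym 'm chart = "'m set \<times> ('m \<Rightarrow> real^2)"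

definition chart_inv :: "'m chart \<Rightarrow> real^2 \<Rightarrow> 'm" where
  "chart_inv c = inv_into (fst c) (snd c)"

definition surface_chart :: "'m topology \<Rightarrow> 'm chart \<Rightarrow> bool" where
  "surface_chart M c \<longleftrightarrow>
     openin M (fst c) \<and>
     openin (top_of_set half_plane) (snd c ` fst c) \<and>
     homeomorphic_map (subtopology M (fst c)) (top_of_set (snd c ` fst c)) (snd c)"

text \<open>
  The atlas need not be maximal: smooth maps, diffeomorphisms and Morse functions
  are the same for any atlas defining the same smooth structure.
\<close>

definition smooth_surface :: "'m topology \<Rightarrow> 'm chart set \<Rightarrow> bool" where
  "smooth_surface M A \<longleftrightarrow>
     Hausdorff_space M \<and> second_countable M \<and>
     (\<forall>c\<in>A. surface_chart M c) \<and> (\<Union>c\<in>A. fst c) = topspace M \<and>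
     (\<forall>c\<in>A. \<forall>d\<in>A. smooth_on (snd c ` (fst c \<inter> fst d)) (snd d \<circ> chart_inv c))"

definition oriented_atlas :: "'m chart set \<Rightarrow> bool" where
  "oriented_atlas A \<longleftrightarrow>
     (\<forall>c\<in>A. \<forall>d\<in>A. \<forall>x \<in> fst c \<inter> fst d.
        det (jacobian (snd d \<circ> chart_inv c)
               (at (snd c x) within snd c ` (fst c \<inter> fst d))) > 0)"

definition compact_connected_oriented_surface :: "'m topology \<Rightarrow> 'm chart set \<Rightarrow> bool" where
  "compact_connected_oriented_surface M A \<longleftrightarrow>
     smooth_surface M A \<and> oriented_atlas A \<and>
     compact_space M \<and> connected_space M \<and> topspace M \<noteq> {}"

abbreviation sphere2 :: "(real^3) topology" where
  "sphere2 \<equiv> top_of_set (sphere 0 1)"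

abbreviation torus2 :: "(complex \<times> complex) topology" where
  "torus2 \<equiv> prod_topology (top_of_set (sphere 0 1)) (top_of_set (sphere 0 1))"

section \<open>Diffeomorphisms, smooth functions, orbits\<close>

definition smooth_self_map :: "'m topology \<Rightarrow> 'm chart set \<Rightarrow> ('m \<Rightarrow> 'm) \<Rightarrow> bool" where
  "smooth_self_map M A h \<longleftrightarrow>
     continuous_map M M h \<and>
     (\<forall>c\<in>A. \<forall>d\<in>A.
        smooth_on (snd c ` {x \<in> fst c. h x \<in> fst d}) (snd d \<circ> h \<circ> chart_inv c))"

definition diffeos :: "'m topology \<Rightarrow> 'm chart set \<Rightarrow> ('m \<Rightarrow> 'm) set" where
  "diffeos M A =
     {h \<in> topspace M \<rightarrow>\<^sub>E topspace M.
        bij_betw h (topspace M) (topspace M) \<and> smooth_self_map M A h \<and>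
        smooth_self_map M A (inv_into (topspace M) h)}"

text \<open>
  The target \<open>P\<close> is the real line or the unit circle, as a closed embedded submanifold of
  the complex plane.  Hence smooth maps to \<open>P\<close> are smooth maps to the plane with values in \<open>P\<close>,
  and the function space carries the topology induced from that of maps to the plane.
\<close>

definition smooth_functions ::
  "'m topology \<Rightarrow> 'm chart set \<Rightarrow> complex set \<Rightarrow> ('m \<Rightarrow> complex) set" where
  "smooth_functions M A P =
     {f \<in> topspace M \<rightarrow>\<^sub>E P. \<forall>c\<in>A. smooth_on (snd c ` fst c) (f \<circ> chart_inv c)}"

text \<open>
  The strong (Whitney) topology, generated by the strong \<open>C\<^sup>r\<close> topologies for all finite \<open>r\<close>:
  a basic neighbourhood is given by a locally finite family of charts \<open>c\<close>, each with a compact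
  set \<open>K\<close> in its domain and a bound \<open>\<epsilon>\<close> on the difference of all partial derivatives of
  order at most \<open>r\<close> over \<open>K\<close>.
\<close>

definition whitney_family ::
  "'m topology \<Rightarrow> 'm chart set \<Rightarrow> ('m chart \<times> 'm set \<times> real) set \<Rightarrow> bool" where
  "whitney_family M A F \<longleftrightarrow>
     (\<forall>(c, K, \<epsilon>) \<in> F. c \<in> A \<and> compactin M K \<and> K \<subseteq> fst c \<and> \<epsilon> > 0) \<and>
     (\<forall>x \<in> topspace M. \<exists>W. openin M W \<and> x \<in> W \<and>
        finite {(c, K, \<epsilon>) \<in> F. fst c \<inter> W \<noteq> {}})"

definition whitney_nbhd ::
  "'m topology \<Rightarrow> 'm chart set \<Rightarrow> complex set \<Rightarrow> nat \<Rightarrow> ('m chart \<times> 'm set \<times> real) set \<Rightarrow>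
   ('m \<Rightarrow> complex) \<Rightarrow> ('m \<Rightarrow> complex) set" where
  "whitney_nbhd M A P r F f =
     {g \<in> smooth_functions M A P.
        \<forall>(c, K, \<epsilon>) \<in> F. \<forall>y \<in> snd c ` K. \<forall>vs. set vs \<subseteq> Basis \<and> length vs \<le> r \<longrightarrow>
          norm (iter_deriv (snd c ` fst c) vs (g \<circ> chart_inv c) y
              - iter_deriv (snd c ` fst c) vs (f \<circ> chart_inv c) y) < \<epsilon>}"

definition whitney_topology ::
  "'m topology \<Rightarrow> 'm chart set \<Rightarrow> complex set \<Rightarrow> ('m \<Rightarrow> complex) topology" where
  "whitney_topology M A P =
     topology_generated_by
       {whitney_nbhd M A P r F f | r F f. whitney_family M A F \<and> f \<in> smooth_functions M A P}"

definition right_orbit ::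
  "'m topology \<Rightarrow> 'm chart set \<Rightarrow> ('m \<Rightarrow> complex) \<Rightarrow> ('m \<Rightarrow> complex) set" where
  "right_orbit M A f = {compose (topspace M) f h | h. h \<in> diffeos M A}"

definition orbit_space ::
  "'m topology \<Rightarrow> 'm chart set \<Rightarrow> complex set \<Rightarrow> ('m \<Rightarrow> complex) \<Rightarrow> ('m \<Rightarrow> complex) topology" where
  "orbit_space M A P f = subtopology (whitney_topology M A P) (right_orbit M A f)"

text \<open>
  The orbit is in general not path connected (for instance when no orientation-reversing
  diffeomorphism preserves \<open>f\<close>), and its homology is then a direct sum over components.  The
  first homology and Betti number of the orbit refer to its path component at \<open>f\<close>, the space
  whose fundamental group is presented.
\<close>

definition orbit_component ::
  "'m topology \<Rightarrow> 'm chart set \<Rightarrow> complex set \<Rightarrow> ('m \<Rightarrow> complex) \<Rightarrow> ('m \<Rightarrow> complex) topology" where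
  "orbit_component M A P f =
     subtopology (orbit_space M A P f) (path_component_of_set (orbit_space M A P f) f)"

text \<open>
  A local coordinate on \<open>P\<close> near \<open>q\<close>; on the circle it is the angle relative to \<open>q\<close>.
  Criticality and the Hessian at \<open>x\<close> are computed for the resulting real-valued
  local representative of \<open>f\<close>, which is smooth near \<open>x\<close> (that is all that matters).
\<close>

definition local_coord :: "complex set \<Rightarrow> complex \<Rightarrow> complex \<Rightarrow> real" where
  "local_coord P q z = (if P = \<real> then Re z else Arg (z / q))"

definition local_rep ::
  "complex set \<Rightarrow> ('m \<Rightarrow> complex) \<Rightarrow> 'm chart \<Rightarrow> 'm \<Rightarrow> real^2 \<Rightarrow> real" where
  "local_rep P f c x = local_coord P (f x) \<circ> f \<circ> chart_inv c"

definition critical_at :: "complex set \<Rightarrow> ('m \<Rightarrow> complex) \<Rightarrow> 'm chart \<Rightarrow> 'm \<Rightarrow> bool" where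
  "critical_at P f c x \<longleftrightarrow>
     (\<forall>v. frechet_derivative (local_rep P f c x) (at (snd c x) within snd c ` fst c) v = 0)"

definition hessian_at :: "complex set \<Rightarrow> ('m \<Rightarrow> complex) \<Rightarrow> 'm chart \<Rightarrow> 'm \<Rightarrow> real^2^2" where
  "hessian_at P f c x =
     (\<chi> i j. iter_deriv (snd c ` fst c) [axis i 1, axis j 1] (local_rep P f c x) (snd c x))"

definition morse ::
  "'m topology \<Rightarrow> 'm chart set \<Rightarrow> complex set \<Rightarrow> ('m \<Rightarrow> complex) \<Rightarrow> bool" where
  "morse M A P f \<longleftrightarrow>
     f \<in> smooth_functions M A P \<and>
     (\<forall>c\<in>A. \<forall>x \<in> fst c. critical_at P f c x \<longrightarrow> det (hessian_at P f c x) \<noteq> 0)"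

section \<open>Fundamental group, Betti number\<close>

definition loops :: "'a topology \<Rightarrow> 'a \<Rightarrow> (real \<Rightarrow> 'a) set" where
  "loops X a = {p. pathin X p \<and> p 0 = a \<and> p 1 = a}"

definition loop_rel :: "'a topology \<Rightarrow> 'a \<Rightarrow> ((real \<Rightarrow> 'a) \<times> (real \<Rightarrow> 'a)) set" where
  "loop_rel X a =
     {(p, q). p \<in> loops X a \<and> q \<in> loops X a \<and>
        homotopic_with (\<lambda>r. r 0 = a \<and> r 1 = a) (top_of_set {0..1}) X p q}"

text \<open>The library's \<open>joinpaths\<close> needs a topology on the type, so it does not apply here.\<close>

definition loop_concat :: "(real \<Rightarrow> 'a) \<Rightarrow> (real \<Rightarrow> 'a) \<Rightarrow> real \<Rightarrow> 'a" where
  "loop_concat p q = (\<lambda>t. if t \<le> 1/2 then p (2 * t) else q (2 * t - 1))"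

definition fundamental_group :: "'a topology \<Rightarrow> 'a \<Rightarrow> (real \<Rightarrow> 'a) set monoid" where
  "fundamental_group X a =
     \<lparr>carrier = loops X a // loop_rel X a,
      monoid.mult = (\<lambda>u v. \<Union>p\<in>u. \<Union>q\<in>v. loop_rel X a `` {loop_concat p q}),
      one = loop_rel X a `` {\<lambda>t. a}\<rparr>"

definition Z_independent :: "('a, 'b) monoid_scheme \<Rightarrow> 'a set \<Rightarrow> bool" where
  "Z_independent G S \<longleftrightarrow>
     finite S \<and> S \<subseteq> carrier G \<and>
     (\<forall>k :: 'a \<Rightarrow> int. finprod G (\<lambda>x. x [^]\<^bsub>G\<^esub> k x) S = \<one>\<^bsub>G\<^esub> \<longrightarrow> (\<forall>x\<in>S. k x = 0))"

definition abelian_rank :: "('a, 'b) monoid_scheme \<Rightarrow> enat" where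
  "abelian_rank G = (SUP S \<in> Collect (Z_independent G). enat (card S))"

definition betti_number :: "int \<Rightarrow> 'a topology \<Rightarrow> enat" where
  "betti_number p X = abelian_rank (homology_group p X)"

abbreviation Z_power :: "nat \<Rightarrow> (nat \<Rightarrow> int) monoid" where
  "Z_power n \<equiv> product_group {..<n} (\<lambda>_. integer_group)"

section \<open>Wreath products with the integers, the class of groups, presentations\<close>

definition semidirect_product ::
  "('a, 'c) monoid_scheme \<Rightarrow> ('b, 'd) monoid_scheme \<Rightarrow> ('b \<Rightarrow> 'a \<Rightarrow> 'a) \<Rightarrow> ('a \<times> 'b) monoid" where
  "semidirect_product N H \<phi> =
     \<lparr>carrier = carrier N \<times> carrier H,
      monoid.mult = (\<lambda>(a, h) (b, k). (a \<otimes>\<^bsub>N\<^esub> \<phi> h b, h \<otimes>\<^bsub>H\<^esub> k)),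
      one = (\<one>\<^bsub>N\<^esub>, \<one>\<^bsub>H\<^esub>)\<rparr>"

definition cyclic_shift :: "nat \<Rightarrow> int \<Rightarrow> (nat \<Rightarrow> 'a) \<Rightarrow> nat \<Rightarrow> 'a" where
  "cyclic_shift n k a = (\<lambda>i\<in>{..<n}. a (nat ((int i + k) mod int n)))"

definition wreath_Z :: "('a, 'b) monoid_scheme \<Rightarrow> nat \<Rightarrow> ((nat \<Rightarrow> 'a) \<times> int) monoid" where
  "wreath_Z G n =
     semidirect_product (product_group {..<n} (\<lambda>_. G)) integer_group (cyclic_shift n)"

text \<open>
  The groups built by iterated products and wreath products have different types.
  To collect them in one type they are transported along the (injective)
  constructors of the following datatype, using the library's \<open>image_group\<close>.
\<close>

datatype gelem = GUnit | GInt int | GPair gelem gelem | GWreath "nat \<Rightarrow> gelem" int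

definition trivial_g :: "gelem monoid" where
  "trivial_g = singleton_group GUnit"

definition int_g :: "gelem monoid" where
  "int_g = image_group GInt integer_group"

definition times_g :: "gelem monoid \<Rightarrow> gelem monoid \<Rightarrow> gelem monoid" where
  "times_g G H = image_group (\<lambda>(a, b). GPair a b) (G \<times>\<times> H)"

definition wreath_g :: "gelem monoid \<Rightarrow> nat \<Rightarrow> gelem monoid" where
  "wreath_g G n = image_group (\<lambda>(a, k). GWreath a k) (wreath_Z G n)"

inductive class_G_base :: "gelem monoid \<Rightarrow> bool" where
  "class_G_base trivial_g"
| "class_G_base G \<Longrightarrow> class_G_base H \<Longrightarrow> class_G_base (times_g G H)"
| "class_G_base G \<Longrightarrow> n \<ge> 1 \<Longrightarrow> class_G_base (wreath_g G n)"

definition class_G :: "('a, 'b) monoid_scheme \<Rightarrow> bool" where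
  "class_G G \<longleftrightarrow> group G \<and> (\<exists>H. class_G_base H \<and> G \<cong> H)"

text \<open>Words in the alphabet, as syntax trees (so that brackets are implicit).\<close>

datatype gword = W1 | WZ | WTimes gword gword | WWreath gword nat

primrec wf_gword :: "gword \<Rightarrow> bool" where
  "wf_gword W1 \<longleftrightarrow> True"
| "wf_gword WZ \<longleftrightarrow> True"
| "wf_gword (WTimes \<alpha> \<beta>) \<longleftrightarrow> wf_gword \<alpha> \<and> wf_gword \<beta>"
| "wf_gword (WWreath \<alpha> n) \<longleftrightarrow> wf_gword \<alpha> \<and> n \<ge> 2"

primrec word_group :: "gword \<Rightarrow> gelem monoid" where
  "word_group W1 = trivial_g"
| "word_group WZ = int_g"
| "word_group (WTimes \<alpha> \<beta>) = times_g (word_group \<alpha>) (word_group \<beta>)"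
| "word_group (WWreath \<alpha> n) = wreath_g (word_group \<alpha>) n"

definition presentation_of :: "gword \<Rightarrow> ('a, 'b) monoid_scheme \<Rightarrow> bool" where
  "presentation_of \<omega> G \<longleftrightarrow> wf_gword \<omega> \<and> word_group \<omega> \<cong> G"

primrec beta1 :: "gword \<Rightarrow> nat" where
  "beta1 W1 = 0"
| "beta1 WZ = 1"
| "beta1 (WTimes \<alpha> \<beta>) = beta1 \<alpha> + beta1 \<beta>"
| "beta1 (WWreath \<alpha> n) = beta1 \<alpha> + 1"

end

theory Submission
  imports Defs
begin

text \<open>
  Only two features of the orbit component \<open>X\<close> matter: it is path connected, and its fundamental
  group is presented by the word.  The Hurewicz homomorphism from \<open>\<pi>\<^sub>1\<close> to \<open>H\<^sub>1\<close> is surjective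
  because joining the vertices of a cycle to the base point turns its edges into loops.  Conversely,
  a homomorphism \<open>t\<close> from \<open>\<pi>\<^sub>1\<close> to the integers, evaluated on the loops so obtained from
  singular 1-simplices, is a cocycle, so \<open>t\<close> vanishes on every loop that bounds.
  The shift in a wreath product with \<open>\<int>\<close> conjugates the \<open>n\<close> factors into one another, so its
  abelianization is that of a single factor times \<open>\<int>\<close>; by recursion on the word, the
  group has a surjection onto \<open>\<int>\<close> to the power \<open>\<beta>\<^sub>1\<close> whose kernel dies in every abelian
  quotient.  This surjection and the Hurewicz homomorphism therefore have the same kernel.
\<close>

section \<open>Path homotopies in abstract topological spaces\<close>

text \<open>The kernel of the Hurewicz map is never identified with the commutator subgroup. Both
  maps out of the fundamental group are surjective, so equal kernels already give isomorphic images.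
  An element of a power of \<int> is zero once all its coordinates are, so the coordinates of the
  surjection are the only homomorphisms against which a bounding loop has to be tested. Their target
  is commutative, which is what lets them be extended additively from edges to chains. That
  \<open>fundamental_group\<close> is a group is not derived from path algebra: it comes with
  membership in \<open>class_G\<close>. Path homotopies only have to supply that products of classes
  are well defined, and the relations needed for cocycles.\<close>

definition path_homotopic :: "'a topology \<Rightarrow> (real \<Rightarrow> 'a) \<Rightarrow> (real \<Rightarrow> 'a) \<Rightarrow> bool" where
  "path_homotopic X p q \<longleftrightarrow>
     homotopic_with (\<lambda>r. r 0 = p 0 \<and> r 1 = p 1) (top_of_set {0..1}) X p q"

definition reverse_path :: "(real \<Rightarrow> 'a) \<Rightarrow> real \<Rightarrow> 'a" where
  "reverse_path p = (\<lambda>t. p (1 - t))"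

lemma path_homotopic_imp:
  assumes "path_homotopic X p q"
  shows "pathin X p" "pathin X q" "q 0 = p 0" "q 1 = p 1"
  using homotopic_with_imp_continuous_maps[OF assms[unfolded path_homotopic_def]]
    homotopic_with_imp_property[OF assms[unfolded path_homotopic_def]]
  by (auto simp: pathin_def)

lemma path_homotopic_refl: "pathin X p \<Longrightarrow> path_homotopic X p p"
  by (simp add: path_homotopic_def pathin_def)

lemma path_homotopic_sym: "path_homotopic X p q \<Longrightarrow> path_homotopic X q p"
  using path_homotopic_imp[of X p q]
  by (simp add: path_homotopic_def homotopic_with_sym)

lemma path_homotopic_trans [trans]:
  "path_homotopic X p q \<Longrightarrow> path_homotopic X q r \<Longrightarrow> path_homotopic X p r"
  using path_homotopic_imp[of X p q]
  by (auto simp: path_homotopic_def intro: homotopic_with_trans)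

lemma path_homotopic_alt:
  "path_homotopic X p q \<longleftrightarrow>
     (\<exists>h. continuous_map (top_of_set ({0..1::real} \<times> {0..1::real})) X h \<and>
        (\<forall>t\<in>{0..1}. h (0, t) = p t \<and> h (1, t) = q t) \<and>
        (\<forall>s\<in>{0..1}. h (s, 0) = p 0 \<and> h (s, 1) = p 1))"
proof -
  have "path_homotopic X p q \<longleftrightarrow>
     (\<exists>h. continuous_map (prod_topology (top_of_set {0..1::real}) (top_of_set {0..1::real})) X h \<and>
        (\<forall>t\<in>topspace (top_of_set {0..1}). h (0, t) = p t) \<and>
        (\<forall>t\<in>topspace (top_of_set {0..1}). h (1, t) = q t) \<and>
        (\<forall>s\<in>{0..1}. h (s, 0) = p 0 \<and> h (s, 1) = p 1))"
    unfolding path_homotopic_def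
    by (subst homotopic_with) (rule refl | simp)+
  then show ?thesis
    by (simp add: prod_topology_subtopology_eu ball_conj_distrib conj_assoc)
qed

text \<open>Composes the straight-line homotopy in \<open>K\<close> with \<open>g\<close>. With
  \<open>K\<close> the unit interval it yields the groupoid laws, with \<open>K\<close> the triangle
  the relation between its edges.\<close>

lemma path_homotopic_compose_convex:
  fixes K :: "'b::real_normed_vector set"
  assumes g: "continuous_map (top_of_set K) X g" and K: "convex K"
    and \<phi>: "continuous_on {0..1} \<phi>" "\<phi> \<in> {0..1} \<rightarrow> K"
    and \<psi>: "continuous_on {0..1} \<psi>" "\<psi> \<in> {0..1} \<rightarrow> K"
    and ends: "\<phi> 0 = \<psi> 0" "\<phi> 1 = \<psi> 1"
  shows "path_homotopic X (g \<circ> \<phi>) (g \<circ> \<psi>)"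
proof -
  define k where "k = (\<lambda>(s, t). (1 - s) *\<^sub>R \<phi> t + s *\<^sub>R \<psi> t)"
  have "continuous_on ({0..1} \<times> {0..1}) k"
    unfolding k_def case_prod_unfold
    by (intro continuous_intros continuous_on_compose2[OF \<phi>(1)] continuous_on_compose2[OF \<psi>(1)])
      auto
  moreover have "k \<in> {0..1} \<times> {0..1} \<rightarrow> K"
    using \<phi>(2) \<psi>(2) K by (auto simp: k_def convex_alt Pi_iff)
  ultimately have "continuous_map (top_of_set ({0..1} \<times> {0..1})) (top_of_set K) k"
    by simp
  then have "continuous_map (top_of_set ({0..1} \<times> {0..1})) X (g \<circ> k)"
    using g continuous_map_compose by blast
  then show ?thesis
    unfolding path_homotopic_alt using ends
    by (intro exI[of _ "g \<circ> k"]) (auto simp: k_def simp flip: scaleR_left_distrib)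
qed

section \<open>Reversal, concatenation and reparametrization of paths\<close>

lemma pathin_compose:
  assumes "continuous_map (top_of_set K) X g" "continuous_on {0..1} \<phi>" "\<phi> \<in> {0..1} \<rightarrow> K"
  shows "pathin X (g \<circ> \<phi>)"
  using assms unfolding pathin_def by (intro continuous_map_compose[of _ "top_of_set K"]) auto

lemma pathin_reverse_path:
  assumes "pathin X p"
  shows "pathin X (reverse_path p)"
proof -
  have "pathin X (p \<circ> (\<lambda>t. 1 - t))"
    using assms by (intro pathin_compose[of "{0..1}"]) (auto simp: pathin_def intro!: continuous_intros)
  then show ?thesis
    by (simp add: reverse_path_def comp_def)
qed

text \<open>The parameter set \<open>S\<close> is kept general: {0..1} serves homotopies, and a
  single point turns the same statement into the gluing of two paths.\<close>

lemma continuous_map_concat: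
  fixes h k :: "real \<times> real \<Rightarrow> 'a"
  assumes h: "continuous_map (top_of_set (S \<times> {0..1})) X h"
    and k: "continuous_map (top_of_set (S \<times> {0..1})) X k"
    and eq: "\<And>s. s \<in> S \<Longrightarrow> h (s, 1) = k (s, 0)"
  shows "continuous_map (top_of_set (S \<times> {0..1})) X
           (\<lambda>(s, t). if t \<le> 1/2 then h (s, 2 * t) else k (s, 2 * t - 1))"
proof -
  let ?T = "top_of_set (S \<times> {0..1::real})"
  let ?f = "\<lambda>x::real \<times> real. (fst x, 2 * snd x)" and ?g = "\<lambda>x::real \<times> real. (fst x, 2 * snd x - 1)"
  have f: "continuous_map (subtopology ?T {x \<in> topspace ?T. snd x \<le> 1/2}) X (h \<circ> ?f)"
    by (rule continuous_map_compose[OF _ h])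
      (auto simp: subtopology_subtopology intro!: continuous_intros)
  have g: "continuous_map (subtopology ?T {x \<in> topspace ?T. 1/2 \<le> snd x}) X (k \<circ> ?g)"
    by (rule continuous_map_compose[OF _ k])
      (auto simp: subtopology_subtopology intro!: continuous_intros)
  have "continuous_map ?T X (\<lambda>x. if snd x \<le> 1/2 then (h \<circ> ?f) x else (k \<circ> ?g) x)"
  proof (rule continuous_map_cases_le[OF _ _ f g])
    show "(h \<circ> ?f) x = (k \<circ> ?g) x" if "x \<in> topspace ?T" "snd x = 1/2" for x
    proof -
      have "2 * snd x = 1" using that by simp
      then have "h (fst x, 2 * snd x) = k (fst x, 2 * snd x - 1)"
        using that eq[of "fst x"] by (auto simp only: diff_self topspace_euclidean_subtopology mem_Times_iff)
      then show ?thesis by simp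
    qed
  qed (auto intro!: continuous_intros)
  then show ?thesis
    by (simp add: case_prod_unfold cong: if_cong)
qed

lemma pathin_concat:
  assumes "pathin X p" "pathin X q" "p 1 = q 0"
  shows "pathin X (loop_concat p q)"
proof -
  have *: "continuous_map (top_of_set ({0} \<times> {0..1})) X (r \<circ> snd)" if "pathin X r"
    for r :: "real \<Rightarrow> 'a"
    using that unfolding pathin_def
    by (intro continuous_map_compose[of _ "top_of_set {0..1}"]) (auto intro!: continuous_intros)
  have "pathin X ((\<lambda>(s, t). if t \<le> 1/2 then (p \<circ> snd) (s, 2 * t) else (q \<circ> snd) (s, 2 * t - 1)) \<circ> (\<lambda>t. (0::real, t)))"
    by (rule pathin_compose[OF continuous_map_concat[OF *[OF assms(1)] *[OF assms(2)]]])
      (use assms(3) in \<open>auto intro!: continuous_intros\<close>)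
  then show ?thesis
    by (simp add: comp_def loop_concat_def cong: if_cong)
qed

lemma loop_concat_ends [simp]: "loop_concat p q 0 = p 0" "loop_concat p q 1 = q 1"
  by (auto simp: loop_concat_def)

lemma reverse_path_ends [simp]: "reverse_path p 0 = p 1" "reverse_path p 1 = p 0"
  by (auto simp: reverse_path_def)

lemma path_homotopic_concat:
  assumes "path_homotopic X p p'" "path_homotopic X q q'" "p 1 = q 0"
  shows "path_homotopic X (loop_concat p q) (loop_concat p' q')"
proof -
  obtain h where h: "continuous_map (top_of_set ({0..1::real} \<times> {0..1})) X h"
      "\<forall>t\<in>{0..1}. h (0, t) = p t \<and> h (1, t) = p' t" "\<forall>s\<in>{0..1}. h (s, 0) = p 0 \<and> h (s, 1) = p 1"
    using assms(1) unfolding path_homotopic_alt by blast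
  obtain k where k: "continuous_map (top_of_set ({0..1::real} \<times> {0..1})) X k"
      "\<forall>t\<in>{0..1}. k (0, t) = q t \<and> k (1, t) = q' t" "\<forall>s\<in>{0..1}. k (s, 0) = q 0 \<and> k (s, 1) = q 1"
    using assms(2) unfolding path_homotopic_alt by blast
  show ?thesis
    unfolding path_homotopic_alt
    by (rule exI[of _ "\<lambda>(s, t). if t \<le> 1/2 then h (s, 2 * t) else k (s, 2 * t - 1)"], intro conjI)
      (rule continuous_map_concat[OF h(1) k(1)], use h k assms(3) in \<open>auto simp: loop_concat_def\<close>)
qed

text \<open>Paths are functions on all reals, but only their values on {0..1} count.\<close>

lemma path_homotopic_cong:
  assumes "pathin X p" "\<And>t. t \<in> {0..1} \<Longrightarrow> p t = q t"
  shows "path_homotopic X p q"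
  using assms by (auto simp: path_homotopic_def pathin_def intro!: homotopic_with_equal)

text \<open>No monotonicity is asked of \<phi> and \<psi>: two self-maps of the interval with the
  same end values are joined by a straight line. So each groupoid law below only needs two
  reparametrizations of one path.\<close>

lemma path_homotopic_reparametrize:
  assumes p: "pathin X p"
    and \<phi>: "continuous_on {0..1} \<phi>" "\<phi> \<in> {0..1} \<rightarrow> {0..1}"
    and \<psi>: "continuous_on {0..1} \<psi>" "\<psi> \<in> {0..1} \<rightarrow> {0..1}"
    and ends: "\<phi> 0 = \<psi> 0" "\<phi> 1 = \<psi> 1"
    and q: "\<And>t. t \<in> {0..1} \<Longrightarrow> q t = p (\<phi> t)" and r: "\<And>t. t \<in> {0..1} \<Longrightarrow> r t = p (\<psi> t)"
  shows "path_homotopic X q r"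
proof -
  have "path_homotopic X (p \<circ> \<phi>) (p \<circ> \<psi>)"
    using p \<phi> \<psi> ends by (intro path_homotopic_compose_convex) (auto simp: pathin_def)
  moreover have "path_homotopic X (p \<circ> \<phi>) q" "path_homotopic X (p \<circ> \<psi>) r"
    using path_homotopic_imp[OF \<open>path_homotopic X (p \<circ> \<phi>) (p \<circ> \<psi>)\<close>] q r
    by (auto intro!: path_homotopic_cong)
  ultimately show ?thesis
    using path_homotopic_sym path_homotopic_trans by blast
qed

lemma path_homotopic_assoc:
  assumes "pathin X p" "pathin X q" "pathin X r" "p 1 = q 0" "q 1 = r 0"
  shows "path_homotopic X (loop_concat (loop_concat p q) r) (loop_concat p (loop_concat q r))"
\<comment> \<open>The breakpoints 1/4 and 1/2 of the left bracketing must go to 1/2 and 3/4. The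
  piecewise linear map doing this has slopes 2, 1, 1/2, so it is concave and is the minimum of its
  three pieces.\<close>
proof (rule path_homotopic_reparametrize
    [where p = "loop_concat p (loop_concat q r)"
      and \<phi> = "\<lambda>t. min (2 * t) (min (t + 1/4) ((t + 1) / 2))" and \<psi> = "\<lambda>t. t"])
  show "loop_concat (loop_concat p q) r t
      = loop_concat p (loop_concat q r) (min (2 * t) (min (t + 1/4) ((t + 1) / 2)))"
    if "t \<in> {0..1}" for t
  proof -
    consider "t \<le> 1/4" | "1/4 < t" "t \<le> 1/2" | "1/2 < t" by linarith
    then show ?thesis
    proof cases
      case 2
      then have "min (2 * t) (min (t + 1/4) ((t + 1) / 2)) = t + 1/4" by auto
      then show ?thesis using 2 that assms(4,5) by (auto simp: loop_concat_def algebra_simps)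
    qed (use that assms(4,5) in \<open>auto simp: loop_concat_def min_def field_simps\<close>)
  qed
qed (use assms in \<open>auto simp: min_le_iff_disj intro!: pathin_concat continuous_intros\<close>)

text \<open>Going out and back is \<open>p\<close> after a tent function, which vanishes at both
  ends like the constant 0, so it contracts along \<open>p\<close>.\<close>

lemma path_homotopic_concat_reverse:
  assumes "pathin X p"
  shows "path_homotopic X (loop_concat p (reverse_path p)) (\<lambda>t. p 0)"
proof (rule path_homotopic_reparametrize[OF assms, where \<phi> = "\<lambda>t. min (2 * t) (2 - 2 * t)" and \<psi> = "\<lambda>t. 0"])
  show "loop_concat p (reverse_path p) t = p (min (2 * t) (2 - 2 * t))" for t
    by (cases "t < 1/2"; cases "t = 1/2") (auto simp: loop_concat_def reverse_path_def)
qed (auto simp: min_le_iff_disj le_max_iff_disj intro!: continuous_intros)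

lemma path_homotopic_reverse_concat:
  assumes "pathin X p"
  shows "path_homotopic X (loop_concat (reverse_path p) p) (\<lambda>t. p 1)"
proof (rule path_homotopic_reparametrize[OF assms, where \<phi> = "\<lambda>t. max (1 - 2 * t) (2 * t - 1)" and \<psi> = "\<lambda>t. 1"])
  show "loop_concat (reverse_path p) p t = p (max (1 - 2 * t) (2 * t - 1))" for t
    by (cases "t < 1/2"; cases "t = 1/2") (auto simp: loop_concat_def reverse_path_def)
qed (auto simp: min_le_iff_disj le_max_iff_disj intro!: continuous_intros)

lemma path_homotopic_const_concat:
  assumes "pathin X p"
  shows "path_homotopic X (loop_concat (\<lambda>t. p 0) p) p"
proof (rule path_homotopic_reparametrize[OF assms, where \<phi> = "\<lambda>t. max 0 (2 * t - 1)" and \<psi> = "\<lambda>t. t"])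
  show "loop_concat (\<lambda>t. p 0) p t = p (max 0 (2 * t - 1))" for t
    by (cases "t < 1/2"; cases "t = 1/2") (auto simp: loop_concat_def reverse_path_def)
qed (auto simp: min_le_iff_disj le_max_iff_disj intro!: continuous_intros)

text \<open>The 2-simplex with \<open>x 0\<close> eliminated: (u, v) stands for (\<open>x 1\<close>,
  \<open>x 2\<close>), and the vertices 0, 1, 2 are the origin, (1, 0) and (0, 1).\<close>

definition triangle :: "(real \<times> real) set" where
  "triangle = {(u, v). 0 \<le> u \<and> 0 \<le> v \<and> u + v \<le> 1}"

lemma convex_triangle: "convex triangle"
proof (rule convexI)
  fix x y :: "real \<times> real" and s t :: real
  assume *: "x \<in> triangle" "y \<in> triangle" "0 \<le> s" "0 \<le> t" "s + t = 1"
  have "s * (fst x + snd x) + t * (fst y + snd y) \<le> 1"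
    using * by (intro convex_bound_le) (auto simp: triangle_def)
  then show "s *\<^sub>R x + t *\<^sub>R y \<in> triangle"
    using * by (auto simp: triangle_def algebra_simps)
qed

text \<open>Both routes from vertex 0 to vertex 2 lie in a convex set. This relation is what later
  makes a cochain vanish on boundaries.\<close>

lemma path_homotopic_triangle:
  assumes "continuous_map (top_of_set triangle) X g"
  shows "path_homotopic X (loop_concat (\<lambda>t. g (t, 0)) (\<lambda>t. g (1 - t, t))) (\<lambda>t. g (0, t))"
proof -
  \<comment> \<open>Runs along the bottom edge until time 1/2, then along the hypotenuse.\<close>
  let ?\<phi> = "\<lambda>t::real. (min (2 * t) (2 - 2 * t), max 0 (2 * t - 1))"
  have *: "path_homotopic X (g \<circ> ?\<phi>) (g \<circ> (\<lambda>t. (0, t)))"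
    using assms by (intro path_homotopic_compose_convex[OF _ convex_triangle])
      (auto simp: triangle_def min_le_iff_disj intro!: continuous_intros)
  moreover have "path_homotopic X (g \<circ> ?\<phi>) (loop_concat (\<lambda>t. g (t, 0)) (\<lambda>t. g (1 - t, t)))"
  proof (rule path_homotopic_cong)
    show "(g \<circ> ?\<phi>) t = loop_concat (\<lambda>t. g (t, 0)) (\<lambda>t. g (1 - t, t)) t" for t
      by (cases "t < 1/2"; cases "t = 1/2") (auto simp: loop_concat_def)
  qed (rule path_homotopic_imp[OF *])
  ultimately show ?thesis
    using path_homotopic_sym path_homotopic_trans by (fastforce simp: comp_def)
qed

section \<open>Paths and triangles as singular simplices\<close>

text \<open>Time is the barycentric coordinate \<open>x 1\<close>, so the path runs from vertex 0 to
  vertex 1. The restriction supplies the extensionality that \<open>singular_simplex\<close>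
  demands.\<close>

definition path_simplex :: "(real \<Rightarrow> 'a) \<Rightarrow> (nat \<Rightarrow> real) \<Rightarrow> 'a" where
  "path_simplex p = restrict (\<lambda>x. p (x 1)) (standard_simplex 1)"

definition simplex_path :: "((nat \<Rightarrow> real) \<Rightarrow> 'a) \<Rightarrow> real \<Rightarrow> 'a" where
  "simplex_path \<sigma> = (\<lambda>t. \<sigma> (\<lambda>i. if i = 0 then 1 - t else if i = 1 then t else 0))"

definition triangle_simplex :: "(real \<times> real \<Rightarrow> 'a) \<Rightarrow> (nat \<Rightarrow> real) \<Rightarrow> 'a" where
  "triangle_simplex g = restrict (\<lambda>x. g (x 1, x 2)) (standard_simplex 2)"

definition simplex_triangle :: "((nat \<Rightarrow> real) \<Rightarrow> 'a) \<Rightarrow> real \<times> real \<Rightarrow> 'a" where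
  "simplex_triangle \<sigma> =
     (\<lambda>(u, v). \<sigma> (\<lambda>i. if i = 0 then 1 - u - v else if i = 1 then u else if i = 2 then v else 0))"

definition point_simplex :: "'a \<Rightarrow> (nat \<Rightarrow> real) \<Rightarrow> 'a" where
  "point_simplex x = restrict (\<lambda>_. x) (standard_simplex 0)"

text \<open>The last conjunct rebuilds \<open>x\<close> from one coordinate; this is why a 1-simplex
  can be recovered from its path.\<close>

lemma standard_simplex_1_iff:
  "x \<in> standard_simplex 1 \<longleftrightarrow>
     0 \<le> x 1 \<and> x 1 \<le> 1 \<and> x = (\<lambda>i. if i = 0 then 1 - x 1 else if i = 1 then x 1 else 0)"
proof
  assume "x \<in> standard_simplex 1"
  then have x: "\<forall>i. 0 \<le> x i \<and> x i \<le> 1" "\<forall>i>1. x i = 0" "x 0 + x 1 = 1"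
    by (auto simp: standard_simplex_def)
  then show "0 \<le> x 1 \<and> x 1 \<le> 1 \<and> x = (\<lambda>i. if i = 0 then 1 - x 1 else if i = 1 then x 1 else 0)"
    by (auto simp: fun_eq_iff)
next
  assume *: "0 \<le> x 1 \<and> x 1 \<le> 1 \<and> x = (\<lambda>i. if i = 0 then 1 - x 1 else if i = 1 then x 1 else 0)"
  then have x: "x i = (if i = 0 then 1 - x 1 else if i = 1 then x 1 else 0)" for i
    by meson
  from * have x1: "0 \<le> x 1" "x 1 \<le> 1" by simp_all
  have "0 \<le> x i \<and> x i \<le> 1" for i using x1 by (subst (1 2) x) auto
  moreover have "x i = 0" if "i > 1" for i using that by (subst x) auto
  moreover have "x 0 + x 1 = 1" using x[of 0] by simp
  ultimately show "x \<in> standard_simplex 1"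
    by (auto simp: standard_simplex_def)
qed

lemma standard_simplex_2_iff:
  "x \<in> standard_simplex 2 \<longleftrightarrow>
     0 \<le> x 1 \<and> 0 \<le> x 2 \<and> x 1 + x 2 \<le> 1 \<and>
     x = (\<lambda>i. if i = 0 then 1 - x 1 - x 2 else if i = 1 then x 1 else if i = 2 then x 2 else 0)"
proof
  assume "x \<in> standard_simplex 2"
  then have x: "\<forall>i. 0 \<le> x i \<and> x i \<le> 1" "\<forall>i>2. x i = 0" "x 0 + x 1 + x 2 = 1"
    by (auto simp: standard_simplex_def eval_nat_numeral)
  moreover have "0 \<le> x 0" using x(1) by auto
  then have "x 1 + x 2 \<le> 1" using x(3) by linarith
  ultimately show "0 \<le> x 1 \<and> 0 \<le> x 2 \<and> x 1 + x 2 \<le> 1 \<and>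
     x = (\<lambda>i. if i = 0 then 1 - x 1 - x 2 else if i = 1 then x 1 else if i = 2 then x 2 else 0)"
    by (auto simp: fun_eq_iff)
next
  assume *: "0 \<le> x 1 \<and> 0 \<le> x 2 \<and> x 1 + x 2 \<le> 1 \<and>
     x = (\<lambda>i. if i = 0 then 1 - x 1 - x 2 else if i = 1 then x 1 else if i = 2 then x 2 else 0)"
  then have x: "x i = (if i = 0 then 1 - x 1 - x 2 else if i = 1 then x 1 else if i = 2 then x 2 else 0)" for i
    by meson
  from * have x12: "0 \<le> x 1" "0 \<le> x 2" "x 1 + x 2 \<le> 1" by simp_all
  have "0 \<le> x i \<and> x i \<le> 1" for i using x12 by (subst (1 2) x) auto
  moreover have "x i = 0" if "i > 2" for i using that by (subst x) auto
  moreover have "x 0 + x 1 + x 2 = 1" using x[of 0] by simp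
  ultimately show "x \<in> standard_simplex 2"
    by (auto simp: standard_simplex_def eval_nat_numeral)
qed

lemma continuous_map_standard_simplex_coordinate:
  "continuous_map (subtopology (powertop_real UNIV) S) euclideanreal (\<lambda>x. x i)"
  by (intro continuous_map_from_subtopology continuous_map_product_projection) auto

lemma singular_simplex_path_simplex:
  assumes "pathin X p"
  shows "singular_simplex 1 X (path_simplex p)"
proof -
  let ?T = "subtopology (powertop_real UNIV) (standard_simplex 1)"
  have "continuous_map ?T X (p \<circ> (\<lambda>x. x 1))"
  proof (rule continuous_map_compose[of _ "top_of_set {0..1}"])
    show "continuous_map ?T (top_of_set {0..1}) (\<lambda>x. x 1)"
      using continuous_map_standard_simplex_coordinate[of "standard_simplex 1" 1]
      by (auto simp: continuous_map_in_subtopology standard_simplex_def)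
  qed (use assms in \<open>simp add: pathin_def\<close>)
  then show ?thesis
    unfolding singular_simplex_def path_simplex_def
    by (auto elim!: continuous_map_eq)
qed

lemma pathin_simplex_path:
  assumes "singular_simplex 1 X \<sigma>"
  shows "pathin X (simplex_path \<sigma>)"
proof -
  let ?e = "\<lambda>t::real. \<lambda>i::nat. if i = 0 then 1 - t else if i = 1 then t else 0"
  have "continuous_map (top_of_set {0..1}) (powertop_real UNIV) ?e"
    unfolding continuous_map_componentwise_UNIV
  proof
    show "continuous_map (top_of_set {0..1}) euclideanreal
        (\<lambda>t. if i = 0 then 1 - t else if i = 1 then t else 0)" for i :: nat
      by (cases "i = 0"; cases "i = 1") (auto intro!: continuous_intros)
  qed
  then have "continuous_map (top_of_set {0..1})
      (subtopology (powertop_real UNIV) (standard_simplex 1)) ?e"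
    by (auto simp: continuous_map_in_subtopology standard_simplex_def)
  then show ?thesis
    using continuous_map_compose[OF _ conjunct1[OF assms[unfolded singular_simplex_def]]]
    unfolding pathin_def simplex_path_def comp_def by blast
qed

lemma path_simplex_simplex_path:
  assumes "singular_simplex 1 X \<sigma>"
  shows "path_simplex (simplex_path \<sigma>) = \<sigma>"
proof
  show "path_simplex (simplex_path \<sigma>) x = \<sigma> x" for x
  proof (cases "x \<in> standard_simplex 1")
    case True
    then have "(\<lambda>i. if i = 0 then 1 - x 1 else if i = 1 then x 1 else 0) = x"
      unfolding standard_simplex_1_iff by (elim conjE) (erule sym)
    then have "\<sigma> (\<lambda>i. if i = 0 then 1 - x 1 else if i = 1 then x 1 else 0) = \<sigma> x"
      by (rule arg_cong)
    then show ?thesis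
      using True by (simp add: path_simplex_def simplex_path_def del: One_nat_def)
  qed (use assms in \<open>auto simp: path_simplex_def singular_simplex_def extensional_def\<close>)
qed

lemma path_simplex_cong:
  assumes "\<And>t. t \<in> {0..1} \<Longrightarrow> p t = q t"
  shows "path_simplex p = path_simplex q"
  using assms by (auto simp: path_simplex_def standard_simplex_def fun_eq_iff restrict_def)

lemma simplex_path_path_simplex: "t \<in> {0..1} \<Longrightarrow> simplex_path (path_simplex p) t = p t"
proof -
  assume t: "t \<in> {0..1}"
  then have "(\<lambda>i. if i = 0 then 1 - t else if i = 1 then t else 0) \<in> standard_simplex 1"
    by (auto simp: standard_simplex_def)
  then show ?thesis
    by (simp add: path_simplex_def simplex_path_def)
qed

lemma singular_simplex_triangle_simplex:
  assumes "continuous_map (top_of_set triangle) X g"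
  shows "singular_simplex 2 X (triangle_simplex g)"
proof -
  let ?T = "subtopology (powertop_real UNIV) (standard_simplex 2)"
  have "continuous_map ?T X (g \<circ> (\<lambda>x. (x 1, x 2)))"
  proof (rule continuous_map_compose[OF _ assms])
    have "continuous_map ?T (prod_topology euclideanreal euclideanreal) (\<lambda>x. (x 1, x 2))"
      by (intro continuous_map_pairedI continuous_map_standard_simplex_coordinate)
    then show "continuous_map ?T (top_of_set triangle) (\<lambda>x. (x 1, x 2))"
      by (auto simp: continuous_map_in_subtopology triangle_def standard_simplex_2_iff)
  qed
  then show ?thesis
    unfolding singular_simplex_def triangle_simplex_def
    by (auto elim!: continuous_map_eq)
qed

lemma continuous_map_simplex_triangle:
  assumes "singular_simplex 2 X \<sigma>"
  shows "continuous_map (top_of_set triangle) X (simplex_triangle \<sigma>)"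
proof -
  let ?e = "\<lambda>(u::real, v::real). \<lambda>i::nat.
      if i = 0 then 1 - u - v else if i = 1 then u else if i = 2 then v else 0"
  have "continuous_map (top_of_set triangle) (powertop_real UNIV) ?e"
    unfolding continuous_map_componentwise_UNIV case_prod_unfold
  proof
    show "continuous_map (top_of_set triangle) euclideanreal
        (\<lambda>x. if i = 0 then 1 - fst x - snd x else if i = 1 then fst x else if i = 2 then snd x else 0)"
      for i :: nat
      by (cases "i = 0"; cases "i = 1"; cases "i = 2") (auto intro!: continuous_intros)
  qed
  then have "continuous_map (top_of_set triangle)
      (subtopology (powertop_real UNIV) (standard_simplex 2)) ?e"
    by (auto simp: continuous_map_in_subtopology standard_simplex_2_iff triangle_def)
  moreover have "simplex_triangle \<sigma> = \<sigma> \<circ> ?e"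
    by (auto simp: simplex_triangle_def)
  ultimately show ?thesis
    using continuous_map_compose[OF _ conjunct1[OF assms[unfolded singular_simplex_def]]]
    by simp
qed

lemma triangle_simplex_simplex_triangle:
  assumes "singular_simplex 2 X \<sigma>"
  shows "triangle_simplex (simplex_triangle \<sigma>) = \<sigma>"
proof
  show "triangle_simplex (simplex_triangle \<sigma>) x = \<sigma> x" for x
  proof (cases "x \<in> standard_simplex 2")
    case True
    then have "(\<lambda>i. if i = 0 then 1 - x 1 - x 2 else if i = 1 then x 1 else if i = 2 then x 2 else 0) = x"
      unfolding standard_simplex_2_iff by (elim conjE) (erule sym)
    then have "\<sigma> (\<lambda>i. if i = 0 then 1 - x 1 - x 2 else if i = 1 then x 1 else if i = 2 then x 2 else 0) = \<sigma> x"
      by (rule arg_cong)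
    then show ?thesis
      using True by (simp add: triangle_simplex_def simplex_triangle_def del: One_nat_def)
  qed (use assms in \<open>auto simp: triangle_simplex_def singular_simplex_def extensional_def\<close>)
qed

lemma singular_face_restrict_eq:
  assumes "k \<le> Suc p"
  shows "singular_face (Suc p) k (restrict f (standard_simplex (Suc p))) =
    restrict (f \<circ> simplical_face k) (standard_simplex p)"
  using assms by (subst singular_face_restrict) (auto simp: singular_face_def)

text \<open>Face \<open>k\<close> is the edge opposite vertex \<open>k\<close>, run from the lower
  to the higher remaining vertex.\<close>

lemma singular_face_triangle_simplex:
  "singular_face 2 0 (triangle_simplex g) = path_simplex (\<lambda>t. g (1 - t, t))"
  "singular_face 2 1 (triangle_simplex g) = path_simplex (\<lambda>t. g (0, t))"
  "singular_face 2 2 (triangle_simplex g) = path_simplex (\<lambda>t. g (t, 0))"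
proof -
  \<comment> \<open>Face 0 evaluates \<open>g\<close> at (\<open>x 0\<close>, \<open>x 1\<close>),
    so the eliminated coordinate must be expressed by the other one.\<close>
  have "x 0 = 1 - x (Suc 0)" if "x \<in> standard_simplex (Suc 0)" for x
    using that by (auto simp: standard_simplex_def)
  then show "singular_face 2 0 (triangle_simplex g) = path_simplex (\<lambda>t. g (1 - t, t))"
    "singular_face 2 1 (triangle_simplex g) = path_simplex (\<lambda>t. g (0, t))"
    "singular_face 2 2 (triangle_simplex g) = path_simplex (\<lambda>t. g (t, 0))"
    unfolding triangle_simplex_def path_simplex_def
    using singular_face_restrict_eq[of _ "Suc 0" "\<lambda>x. g (x 1, x 2)"]
    by (auto simp: numeral_2_eq_2 simplical_face_def intro!: restrict_ext)
qed

lemma chain_boundary_triangle_simplex: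
  "chain_boundary 2 (frag_of (triangle_simplex g)) =
     frag_of (path_simplex (\<lambda>t. g (1 - t, t))) - frag_of (path_simplex (\<lambda>t. g (0, t)))
     + frag_of (path_simplex (\<lambda>t. g (t, 0)))"
proof -
  have "{..2} = {0, 1, 2::nat}" by auto
  then show ?thesis
    by (simp add: chain_boundary_of singular_face_triangle_simplex
        singular_face_triangle_simplex(2)[simplified])
qed

lemma chain_boundary_path_simplex:
  "chain_boundary 1 (frag_of (path_simplex p)) =
     frag_of (point_simplex (p 1)) - frag_of (point_simplex (p 0))"
proof -
  have "{..Suc 0} = {0, 1}" by auto
  moreover have "singular_face (Suc 0) 0 (path_simplex p) = point_simplex (p 1)"
    "singular_face (Suc 0) (Suc 0) (path_simplex p) = point_simplex (p 0)"
    unfolding path_simplex_def point_simplex_def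
    using singular_face_restrict_eq[of _ 0 "\<lambda>x. p (x 1)"]
    by (auto simp: simplical_face_def standard_simplex_0 intro!: restrict_ext)
  ultimately show ?thesis
    by (simp add: chain_boundary_of)
qed

section \<open>Homologies between paths\<close>

abbreviation boundary1 :: "'a topology \<Rightarrow> 'a chain \<Rightarrow> bool" where
  "boundary1 X \<equiv> singular_relboundary 1 X {}"

lemma boundary1_triangle:
  assumes "continuous_map (top_of_set triangle) X g"
  shows "boundary1 X (frag_of (path_simplex (\<lambda>t. g (1 - t, t)))
    - frag_of (path_simplex (\<lambda>t. g (0, t))) + frag_of (path_simplex (\<lambda>t. g (t, 0))))"
  unfolding singular_boundary
  using singular_simplex_triangle_simplex[OF assms] chain_boundary_triangle_simplex[of g]
  by (intro exI[of _ "frag_of (triangle_simplex g)"]) (simp add: singular_chain_of eval_nat_numeral)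

text \<open>The three faces of a constant triangle agree and carry the signs +, -, +, so one copy
  survives.\<close>

lemma boundary1_const:
  assumes "x \<in> topspace X"
  shows "boundary1 X (frag_of (path_simplex (\<lambda>t. x)))"
  using boundary1_triangle[of X "\<lambda>z. x"] assms by simp

lemma boundary1_concat:
  assumes "pathin X p" "pathin X q" "p 1 = q 0"
  shows "boundary1 X (frag_of (path_simplex (loop_concat p q))
    - frag_of (path_simplex p) - frag_of (path_simplex q))"
proof -
  \<comment> \<open>The affine map sends the vertices 0, 1, 2 to the times 0, 1/2, 1, so that the
    edges are \<open>p\<close>, \<open>q\<close> and their concatenation.\<close>
  define g where "g = loop_concat p q \<circ> (\<lambda>(u::real, v). u / 2 + v)"
  have "continuous_map (top_of_set triangle) X g"
    unfolding g_def using pathin_concat[OF assms] unfolding pathin_def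
    by (rule continuous_map_compose[rotated])
      (auto simp: triangle_def case_prod_unfold intro!: continuous_intros)
  from boundary1_triangle[OF this]
  have "boundary1 X (frag_of (path_simplex (\<lambda>t. g (1 - t, t)))
    - frag_of (path_simplex (\<lambda>t. g (0, t))) + frag_of (path_simplex (\<lambda>t. g (t, 0))))" .
  moreover have "path_simplex (\<lambda>t. g (1 - t, t)) = path_simplex q"
  proof (rule path_simplex_cong)
    fix t :: real
    have "(1 - t) / 2 + t = (1 + t) / 2" by (simp add: field_simps)
    then have "g (1 - t, t) = loop_concat p q ((1 + t) / 2)"
      by (simp only: g_def comp_def case_prod_conv)
    \<comment> \<open>At t = 0 the argument is 1/2, which \<open>loop_concat\<close> assigns to
      \<open>p\<close>; there the matching end points are used.\<close>
    then show "g (1 - t, t) = q t" if "t \<in> {0..1}"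
      using that assms(3) by (cases "t = 0") (auto simp: loop_concat_def add_divide_distrib)
  qed
  moreover have "path_simplex (\<lambda>t. g (t, 0)) = path_simplex p"
    by (rule path_simplex_cong) (auto simp: g_def loop_concat_def)
  moreover have "(\<lambda>t. g (0, t)) = loop_concat p q"
    by (simp add: g_def)
  ultimately have "boundary1 X (- (frag_of (path_simplex (loop_concat p q))
    - frag_of (path_simplex p) - frag_of (path_simplex q)))"
    by (simp add: algebra_simps)
  then show ?thesis
    by (simp only: singular_relboundary_minus)
qed

text \<open>The square of the homotopy is cut along its diagonal into two triangles. The diagonal
  cancels in their difference, and the remaining two sides are constant paths, hence boundaries
  themselves.\<close>

lemma boundary1_homotopic:
  assumes "path_homotopic X p q"
  shows "boundary1 X (frag_of (path_simplex p) - frag_of (path_simplex q))"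
proof -
  obtain h where h: "continuous_map (top_of_set ({0..1::real} \<times> {0..1::real})) X h"
      "\<forall>t\<in>{0..1}. h (0, t) = p t \<and> h (1, t) = q t" "\<forall>s\<in>{0..1}. h (s, 0) = p 0 \<and> h (s, 1) = p 1"
    using assms(1) unfolding path_homotopic_alt by blast
  \<comment> \<open>In the square, the vertices of \<open>g\<close> are (0, 0), (0, 1), (1, 1) and
    those of \<open>k\<close> are (0, 0), (1, 0), (1, 1); the diagonal is the edge from vertex 0 to
    vertex 2 in both.\<close>
  define g where "g = h \<circ> (\<lambda>(u, v). (v, u + v))"
  define k where "k = h \<circ> (\<lambda>(u, v). (u + v, v))"
  have top: "p 0 \<in> topspace X" "p 1 \<in> topspace X"
    using path_homotopic_imp(1)[OF assms] path_start_in_topspace path_finish_in_topspace by auto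
  have g: "continuous_map (top_of_set triangle) X g"
    unfolding g_def
    by (rule continuous_map_compose[OF _ h(1)])
      (auto simp: triangle_def case_prod_unfold intro!: continuous_intros)
  have k: "continuous_map (top_of_set triangle) X k"
    unfolding k_def
    by (rule continuous_map_compose[OF _ h(1)])
      (auto simp: triangle_def case_prod_unfold intro!: continuous_intros)
  have *: "path_simplex (\<lambda>t. g (1 - t, t)) = path_simplex (\<lambda>t. p 1)"
    "path_simplex (\<lambda>t. g (t, 0)) = path_simplex p"
    "path_simplex (\<lambda>t. k (1 - t, t)) = path_simplex q"
    "path_simplex (\<lambda>t. k (t, 0)) = path_simplex (\<lambda>t. p 0)"
    "path_simplex (\<lambda>t. g (0, t)) = path_simplex (\<lambda>t. h (t, t))"
    "path_simplex (\<lambda>t. k (0, t)) = path_simplex (\<lambda>t. h (t, t))"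
    using h(2,3) by (auto simp: g_def k_def intro!: path_simplex_cong)
  have "boundary1 X (frag_of (path_simplex (\<lambda>t. p 1)) - frag_of (path_simplex (\<lambda>t. h (t, t)))
       + frag_of (path_simplex p))"
    "boundary1 X (frag_of (path_simplex q) - frag_of (path_simplex (\<lambda>t. h (t, t)))
       + frag_of (path_simplex (\<lambda>t. p 0)))"
    using boundary1_triangle[OF g] boundary1_triangle[OF k] unfolding * by auto
  from singular_relboundary_diff[OF singular_relboundary_diff[OF this(1) boundary1_const[OF top(2)]]
      singular_relboundary_diff[OF this(2) boundary1_const[OF top(1)]]]
  show ?thesis
    by (simp add: algebra_simps)
qed

lemma boundary1_reverse:
  assumes "pathin X p"
  shows "boundary1 X (frag_of (path_simplex p) + frag_of (path_simplex (reverse_path p)))"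
proof -
  let ?q = "loop_concat p (reverse_path p)"
  have 1: "boundary1 X (frag_of (path_simplex ?q)
    - frag_of (path_simplex p) - frag_of (path_simplex (reverse_path p)))"
    using assms by (intro boundary1_concat pathin_reverse_path) auto
  have 2: "boundary1 X (frag_of (path_simplex ?q) - frag_of (path_simplex (\<lambda>t. p 0)))"
    by (intro boundary1_homotopic path_homotopic_concat_reverse assms)
  have 3: "boundary1 X (frag_of (path_simplex (\<lambda>t. p 0)))"
    using assms path_start_in_topspace by (intro boundary1_const) auto
  show ?thesis
    using singular_relboundary_diff[OF singular_relboundary_add[OF 2 3] 1] by (simp add: add.commute)
qed

section \<open>The fundamental group\<close>

definition loop_class :: "'a topology \<Rightarrow> 'a \<Rightarrow> (real \<Rightarrow> 'a) \<Rightarrow> (real \<Rightarrow> 'a) set" where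
  "loop_class X a p = loop_rel X a `` {p}"

lemma loop_rel_iff:
  "(p, q) \<in> loop_rel X a \<longleftrightarrow> path_homotopic X p q \<and> p 0 = a \<and> p 1 = a"
proof
  assume "(p, q) \<in> loop_rel X a"
  then show "path_homotopic X p q \<and> p 0 = a \<and> p 1 = a"
    by (auto simp: loop_rel_def loops_def path_homotopic_def)
next
  assume *: "path_homotopic X p q \<and> p 0 = a \<and> p 1 = a"
  with path_homotopic_imp[of X p q] have "p \<in> loops X a" "q \<in> loops X a"
    by (auto simp: loops_def)
  with * show "(p, q) \<in> loop_rel X a"
    by (auto simp: loop_rel_def path_homotopic_def)
qed

lemma mem_loop_class_iff:
  "p \<in> loops X a \<Longrightarrow> q \<in> loop_class X a p \<longleftrightarrow> path_homotopic X p q"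
  by (auto simp: loop_class_def loop_rel_iff loops_def)

lemma loop_class_eq_iff:
  assumes "p \<in> loops X a" "q \<in> loops X a"
  shows "loop_class X a p = loop_class X a q \<longleftrightarrow> path_homotopic X p q"
proof
  assume "loop_class X a p = loop_class X a q"
  then have "p \<in> loop_class X a q"
    using assms mem_loop_class_iff[of p X a p] by (auto simp: loops_def path_homotopic_refl)
  then show "path_homotopic X p q"
    using mem_loop_class_iff[OF assms(2)] path_homotopic_sym by blast
next
  assume "path_homotopic X p q"
  then show "loop_class X a p = loop_class X a q"
    using mem_loop_class_iff[OF assms(1)] mem_loop_class_iff[OF assms(2)]
      path_homotopic_sym path_homotopic_trans by blast
qed

lemma loop_concat_in_loops: "p \<in> loops X a \<Longrightarrow> q \<in> loops X a \<Longrightarrow> loop_concat p q \<in> loops X a"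
  by (auto simp: loops_def intro: pathin_concat)

lemma reverse_path_in_loops: "p \<in> loops X a \<Longrightarrow> reverse_path p \<in> loops X a"
  by (auto simp: loops_def intro: pathin_reverse_path)

lemma const_in_loops: "a \<in> topspace X \<Longrightarrow> (\<lambda>t. a) \<in> loops X a"
  by (simp add: loops_def)

lemma carrier_fundamental_group:
  "carrier (fundamental_group X a) = loop_class X a ` loops X a"
  by (auto simp: fundamental_group_def quotient_def loop_class_def)

lemma one_fundamental_group: "\<one>\<^bsub>fundamental_group X a\<^esub> = loop_class X a (\<lambda>t. a)"
  by (simp add: fundamental_group_def loop_class_def)

text \<open>The product is defined as a union over all representatives; homotopy invariance makes
  all sets in that union equal.\<close>

lemma mult_fundamental_group:
  assumes p: "p \<in> loops X a" and q: "q \<in> loops X a"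
  shows "loop_class X a p \<otimes>\<^bsub>fundamental_group X a\<^esub> loop_class X a q =
    loop_class X a (loop_concat p q)"
proof -
  have *: "loop_class X a (loop_concat p' q') = loop_class X a (loop_concat p q)"
    if "p' \<in> loop_class X a p" "q' \<in> loop_class X a q" for p' q'
  proof -
    have h: "path_homotopic X p p'" "path_homotopic X q q'"
      using that assms by (simp_all add: mem_loop_class_iff)
    then have "p' \<in> loops X a" "q' \<in> loops X a"
      using path_homotopic_imp[OF h(1)] path_homotopic_imp[OF h(2)] assms by (auto simp: loops_def)
    moreover have "path_homotopic X (loop_concat p' q') (loop_concat p q)"
      using h assms by (intro path_homotopic_sym[OF path_homotopic_concat]) (auto simp: loops_def)
    ultimately show ?thesis
      using assms by (simp add: loop_class_eq_iff loop_concat_in_loops)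
  qed
  \<comment> \<open>The union collapses to its common value only over nonempty index sets.\<close>
  have ne: "p \<in> loop_class X a p" "q \<in> loop_class X a q"
    using assms by (auto simp: mem_loop_class_iff loops_def path_homotopic_refl)
  have "loop_class X a p \<otimes>\<^bsub>fundamental_group X a\<^esub> loop_class X a q =
      (\<Union>p'\<in>loop_class X a p. \<Union>q'\<in>loop_class X a q. loop_class X a (loop_concat p' q'))"
    by (simp add: fundamental_group_def loop_class_def)
  also have "\<dots> =
      (\<Union>p'\<in>loop_class X a p. \<Union>q'\<in>loop_class X a q. loop_class X a (loop_concat p q))"
    using * by (intro SUP_cong[OF refl]) assumption
  also have "\<dots> = loop_class X a (loop_concat p q)"
    using ne by (metis SUP_const empty_iff)
  finally show ?thesis .
qed

section \<open>Cocycles from homomorphisms of the fundamental group\<close>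

text \<open>An arbitrary choice for each point, with no continuity in \<open>x\<close>; even at
  \<open>a\<close> itself the path need not be constant.\<close>

definition base_path :: "'a topology \<Rightarrow> 'a \<Rightarrow> 'a \<Rightarrow> real \<Rightarrow> 'a" where
  "base_path X a x = (SOME p. pathin X p \<and> p 0 = a \<and> p 1 = x)"

definition based_loop :: "'a topology \<Rightarrow> 'a \<Rightarrow> (real \<Rightarrow> 'a) \<Rightarrow> real \<Rightarrow> 'a" where
  "based_loop X a p = loop_concat (base_path X a (p 0))
     (loop_concat p (reverse_path (base_path X a (p 1))))"

context
  fixes X :: "'a topology" and a :: 'a
  assumes connected: "path_connected_space X" and base: "a \<in> topspace X"
begin

lemma base_path:
  assumes "x \<in> topspace X"
  shows "pathin X (base_path X a x)" "base_path X a x 0 = a" "base_path X a x 1 = x"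
proof -
  have "\<exists>p. pathin X p \<and> p 0 = a \<and> p 1 = x"
    using connected base assms unfolding path_connected_space_def by blast
  from someI_ex[OF this]
  show "pathin X (base_path X a x)" "base_path X a x 0 = a" "base_path X a x 1 = x"
    by (auto simp: base_path_def)
qed

lemma base_path_ends:
  assumes "pathin X p"
  shows "pathin X (base_path X a (p 0))" "base_path X a (p 0) 0 = a" "base_path X a (p 0) 1 = p 0"
    "pathin X (base_path X a (p 1))" "base_path X a (p 1) 0 = a" "base_path X a (p 1) 1 = p 1"
  using base_path path_start_in_topspace[OF assms] path_finish_in_topspace[OF assms] by auto

lemma based_loop_in_loops:
  assumes "pathin X p"
  shows "based_loop X a p \<in> loops X a"
  using base_path_ends[OF assms] assms
  by (auto simp: based_loop_def loops_def intro!: pathin_concat pathin_reverse_path)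

lemma based_loop_homotopic:
  assumes "path_homotopic X p q"
  shows "path_homotopic X (based_loop X a p) (based_loop X a q)"
  using path_homotopic_imp[OF assms] base_path_ends[of p] assms
  by (auto simp: based_loop_def
      intro!: path_homotopic_concat path_homotopic_refl pathin_reverse_path)

text \<open>At the junction the way back to \<open>a\<close> is followed by the same way out again;
  the two cancel, and the rest is rebracketing.\<close>

lemma based_loop_concat:
  assumes p: "pathin X p" and q: "pathin X q" and pq: "p 1 = q 0"
  shows "path_homotopic X (loop_concat (based_loop X a p) (based_loop X a q))
    (based_loop X a (loop_concat p q))"
proof -
  define u where "u = base_path X a (p 0)"
  define v where "v = base_path X a (p 1)"
  define w where "w = base_path X a (q 1)"
  note uvw = base_path_ends[OF p, folded u_def v_def] base_path_ends(4-6)[OF q, folded w_def]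
  define r where "r = loop_concat q (reverse_path w)"
  have r: "pathin X r" "r 0 = p 1" "r 1 = a"
    using uvw q pq by (auto simp: r_def intro!: pathin_concat pathin_reverse_path)
  have v': "pathin X (reverse_path v)"
    using uvw by (simp add: pathin_reverse_path)
  have pv: "pathin X (loop_concat p (reverse_path v))" and vr: "pathin X (loop_concat v r)"
    using uvw v' p r by (auto intro!: pathin_concat)
  have 1: "path_homotopic X (loop_concat (reverse_path v) (loop_concat v r)) r"
  proof -
    have "path_homotopic X (loop_concat (reverse_path v) (loop_concat v r))
      (loop_concat (loop_concat (reverse_path v) v) r)"
      using uvw v' r by (intro path_homotopic_sym[OF path_homotopic_assoc]) auto
    also have "path_homotopic X (loop_concat (loop_concat (reverse_path v) v) r)
      (loop_concat (\<lambda>t. r 0) r)"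
      using path_homotopic_reverse_concat[OF uvw(4)] uvw r
      by (intro path_homotopic_concat path_homotopic_refl) auto
    also have "path_homotopic X (loop_concat (\<lambda>t. r 0) r) r"
      using r by (intro path_homotopic_const_concat)
    finally show ?thesis .
  qed
  have 2: "path_homotopic X (loop_concat (loop_concat p (reverse_path v)) (loop_concat v r))
    (loop_concat (loop_concat p q) (reverse_path w))"
  proof -
    have "path_homotopic X (loop_concat (loop_concat p (reverse_path v)) (loop_concat v r))
      (loop_concat p (loop_concat (reverse_path v) (loop_concat v r)))"
      using uvw v' r p vr by (intro path_homotopic_assoc) auto
    also have "path_homotopic X (loop_concat p (loop_concat (reverse_path v) (loop_concat v r)))
      (loop_concat p r)"
      using 1 p uvw by (intro path_homotopic_concat path_homotopic_refl) auto
    also have "path_homotopic X (loop_concat p r) (loop_concat (loop_concat p q) (reverse_path w))"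
      unfolding r_def using p q pq uvw
      by (intro path_homotopic_sym[OF path_homotopic_assoc] pathin_reverse_path) auto
    finally show ?thesis .
  qed
  have "path_homotopic X
      (loop_concat (loop_concat u (loop_concat p (reverse_path v))) (loop_concat v r))
      (loop_concat u (loop_concat (loop_concat p (reverse_path v)) (loop_concat v r)))"
    using uvw pv vr by (intro path_homotopic_assoc) auto
  also have "path_homotopic X \<dots> (loop_concat u (loop_concat (loop_concat p q) (reverse_path w)))"
    using uvw by (intro path_homotopic_concat[OF path_homotopic_refl 2]) auto
  finally show ?thesis
    using pq by (simp add: based_loop_def u_def v_def w_def r_def)
qed

text \<open>A loop at \<open>a\<close> is merely conjugated by the path chosen at \<open>a\<close>,
  and conjugation is invisible in a commutative target.\<close>

lemma hom_based_loop:
  assumes t: "t \<in> hom (fundamental_group X a) integer_group"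
    and G: "group (fundamental_group X a)"
    and p: "p \<in> loops X a"
  shows "t (loop_class X a (based_loop X a p)) = t (loop_class X a p)"
proof -
  have mult: "t (loop_class X a (loop_concat q r)) = t (loop_class X a q) + t (loop_class X a r)"
    if "q \<in> loops X a" "r \<in> loops X a" for q r
    using hom_mult[OF t, of "loop_class X a q" "loop_class X a r"] that
    by (simp add: carrier_fundamental_group mult_fundamental_group)
  have pp: "pathin X p" "p 0 = a" "p 1 = a"
    using p by (auto simp: loops_def)
  define u where "u = base_path X a a"
  have u: "u \<in> loops X a" "pathin X u" "u 0 = a"
    using base_path[OF base] by (auto simp: u_def loops_def)
  have "loop_class X a (loop_concat u (reverse_path u)) = loop_class X a (\<lambda>t. a)"
    using path_homotopic_concat_reverse[OF u(2)] u const_in_loops[OF base]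
    by (subst loop_class_eq_iff) (auto simp: loop_concat_in_loops reverse_path_in_loops)
  then have "t (loop_class X a (loop_concat u (reverse_path u))) = t (loop_class X a (\<lambda>t. a))"
    by simp
  also have "\<dots> = 0"
    using hom_one[OF t G group_integer_group] by (simp add: one_fundamental_group)
  finally show ?thesis
    using u p pp by (simp add: based_loop_def mult loop_concat_in_loops reverse_path_in_loops
        flip: u_def)
qed

end

text \<open>\<open>frag_extend\<close> takes values in free abelian groups, so the integers are
  represented as the one on the single generator \<open>()\<close>, and the result is read off as a
  coefficient.\<close>

lemma frag_additive_extension:
  fixes T :: "'b \<Rightarrow> int"
  obtains \<Phi> where "\<And>c d. \<Phi> (c - d) = \<Phi> c - \<Phi> d" "\<And>c d. \<Phi> (c + d) = \<Phi> c + \<Phi> d" "\<Phi> 0 = 0"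
    "\<And>x. \<Phi> (frag_of x) = T x"
proof
  let ?\<Phi> = "\<lambda>c. poly_mapping.lookup (frag_extend (\<lambda>x. frag_cmul (T x) (frag_of ())) c) ()"
  show "?\<Phi> (c - d) = ?\<Phi> c - ?\<Phi> d" "?\<Phi> (c + d) = ?\<Phi> c + ?\<Phi> d" for c d
    by (simp_all add: frag_extend_diff frag_extend_add lookup_minus lookup_add)
qed simp_all

lemma hom_eq_zero_if_boundary:
  assumes X: "path_connected_space X" "a \<in> topspace X"
    and G: "group (fundamental_group X a)"
    and t: "t \<in> hom (fundamental_group X a) integer_group"
    and p: "p \<in> loops X a" and bd: "boundary1 X (frag_of (path_simplex p))"
  shows "t (loop_class X a p) = 0"
proof -
  \<comment> \<open>Defined on all paths, not only on loops: this is the 1-cochain attached to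
    \<open>t\<close>.\<close>
  define T where "T q = t (loop_class X a (based_loop X a q))" for q
  have T_cong: "T q = T r" if "path_homotopic X q r" for q r
  proof -
    have "loop_class X a (based_loop X a q) = loop_class X a (based_loop X a r)"
      using path_homotopic_imp[OF that] that X
      by (subst loop_class_eq_iff) (auto intro: based_loop_homotopic based_loop_in_loops)
    then show ?thesis
      by (simp add: T_def)
  qed
  have T_concat: "T (loop_concat q r) = T q + T r" if "pathin X q" "pathin X r" "q 1 = r 0" for q r
  proof -
    have "loop_class X a (loop_concat (based_loop X a q) (based_loop X a r))
        = loop_class X a (based_loop X a (loop_concat q r))"
      using that X
      by (subst loop_class_eq_iff)
        (auto intro!: based_loop_concat based_loop_in_loops loop_concat_in_loops pathin_concat)
    then have "T (loop_concat q r) =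
        t (loop_class X a (loop_concat (based_loop X a q) (based_loop X a r)))"
      by (simp add: T_def)
    also have "\<dots> = T q + T r"
      unfolding T_def
      using hom_mult[OF t, of "loop_class X a (based_loop X a q)" "loop_class X a (based_loop X a r)"] that X
      by (simp add: carrier_fundamental_group mult_fundamental_group based_loop_in_loops)
    finally show ?thesis .
  qed
  obtain \<Phi> where \<Phi>: "\<And>c d. \<Phi> (c - d) = \<Phi> c - \<Phi> d" "\<And>c d. \<Phi> (c + d) = \<Phi> c + \<Phi> d" "\<Phi> 0 = 0"
    "\<And>\<sigma>. \<Phi> (frag_of \<sigma>) = T (simplex_path \<sigma>)"
    using frag_additive_extension[where T = "\<lambda>\<sigma>. T (simplex_path \<sigma>)"] by blast
  \<comment> \<open>A simplex remembers its path only on {0..1}, so the path is recovered up to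
    homotopy and \<open>T_cong\<close> bridges the gap.\<close>
  have \<Phi>_path: "\<Phi> (frag_of (path_simplex q)) = T q" if "pathin X q" for q
    using T_cong[OF path_homotopic_cong[OF that, of "simplex_path (path_simplex q)"]]
    by (simp add: \<Phi>(4) simplex_path_path_simplex)
  obtain d where d: "singular_chain 2 X d" "chain_boundary 2 d = frag_of (path_simplex p)"
    using bd unfolding singular_boundary by (auto simp: numeral_2_eq_2)
  \<comment> \<open>The coboundary vanishes on each 2-simplex by the triangle relation, hence on
    every 2-chain by additivity.\<close>
  have "\<Phi> (chain_boundary 2 d) = 0"
    using d(1)[unfolded singular_chain_def]
  proof (induction d rule: frag_induction)
    case (one \<sigma>)
    then have \<sigma>: "singular_simplex 2 X \<sigma>"
      by simp
    define g where "g = simplex_triangle \<sigma>"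
    have g: "continuous_map (top_of_set triangle) X g"
      unfolding g_def by (rule continuous_map_simplex_triangle[OF \<sigma>])
    have paths: "pathin X (\<lambda>t. g (t, 0))" "pathin X (\<lambda>t. g (1 - t, t))" "pathin X (\<lambda>t. g (0, t))"
      by (rule pathin_compose[OF g, unfolded comp_def];
          auto simp: triangle_def intro!: continuous_intros)+
    have "T (\<lambda>t. g (0, t)) = T (\<lambda>t. g (t, 0)) + T (\<lambda>t. g (1 - t, t))"
      using T_cong[OF path_homotopic_triangle[OF g]] T_concat[OF paths(1,2)] by simp
    moreover have "frag_of \<sigma> = frag_of (triangle_simplex g)"
      by (simp add: g_def triangle_simplex_simplex_triangle[OF \<sigma>])
    ultimately show ?case
      by (simp add: chain_boundary_triangle_simplex \<Phi>(1,2) \<Phi>_path paths)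
  qed (simp_all add: chain_boundary_diff \<Phi>(1,3))
  then have "T p = 0"
    using d(2) \<Phi>_path p by (simp add: loops_def)
  then show ?thesis
    using hom_based_loop[OF X t G p] by (simp add: T_def)
qed

section \<open>The Hurewicz homomorphism\<close>

abbreviation homology_class1 :: "'a topology \<Rightarrow> 'a chain \<Rightarrow> 'a chain set" where
  "homology_class1 X \<equiv> homologous_rel_set 1 X {}"

lemma homology_class1_eq_iff: "homology_class1 X c = homology_class1 X d \<longleftrightarrow> boundary1 X (c - d)"
  unfolding homologous_rel_set_eq by (simp add: homologous_rel_def)

lemma carrier_homology_group_1:
  "carrier (homology_group 1 X) = homology_class1 X ` Collect (singular_relcycle 1 X {})"
  using carrier_relative_homology_group[of 1 X "{}"] by simp

lemma mult_homology_group_1: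
  "homology_class1 X c \<otimes>\<^bsub>homology_group 1 X\<^esub> homology_class1 X d = homology_class1 X (c + d)"
proof -
  have "homology_class1 X c \<otimes>\<^bsub>homology_group 1 X\<^esub> homology_class1 X d
      = (\<Union>r\<in>homology_class1 X c. \<Union>s\<in>homology_class1 X d. {r + s})"
    using mult_relative_homology_group[of 1 X "{}"] by (simp add: fun_eq_iff)
  also have "\<dots> = homology_class1 X (c + d)"
  proof (intro equalityI subsetI)
    fix x assume "x \<in> homology_class1 X (c + d)"
    then have "homologous_rel 1 X {} d (x - c)"
      by (simp add: homologous_rel_def algebra_simps)
    then show "x \<in> (\<Union>r\<in>homology_class1 X c. \<Union>s\<in>homology_class1 X d. {r + s})"
      by (intro UN_I[of c] UN_I[of "x - c"]) auto
  qed (auto intro: homologous_rel_add)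
  finally show ?thesis .
qed

lemma one_homology_group_1: "\<one>\<^bsub>homology_group 1 X\<^esub> = homology_class1 X 0"
  using one_relative_homology_group[of 1 X "{}"] homologous_rel_set_eq_relboundary[of 1 X "{}" 0]
  by simp

lemma relcycle_path_simplex:
  assumes "pathin X p" "p 0 = p 1"
  shows "singular_relcycle 1 X {} (frag_of (path_simplex p))"
  using singular_simplex_path_simplex[OF assms(1)] chain_boundary_path_simplex[of p] assms(2)
  by (simp add: singular_cycle singular_chain_of)

text \<open>The choice of a representative does not matter because homotopic paths are
  homologous.\<close>

definition hurewicz :: "'a topology \<Rightarrow> (real \<Rightarrow> 'a) set \<Rightarrow> 'a chain set" where
  "hurewicz X u = homology_class1 X (frag_of (path_simplex (SOME p. p \<in> u)))"

lemma hurewicz_loop_class: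
  assumes "p \<in> loops X a"
  shows "hurewicz X (loop_class X a p) = homology_class1 X (frag_of (path_simplex p))"
proof -
  have "p \<in> loop_class X a p"
    using assms by (auto simp: mem_loop_class_iff loops_def path_homotopic_refl)
  then have "(SOME q. q \<in> loop_class X a p) \<in> loop_class X a p"
    by (rule someI[of "\<lambda>q. q \<in> loop_class X a p"])
  then have "path_homotopic X (SOME q. q \<in> loop_class X a p) p"
    using assms by (intro path_homotopic_sym[of X p]) (simp add: mem_loop_class_iff)
  then show ?thesis
    unfolding hurewicz_def homology_class1_eq_iff by (rule boundary1_homotopic)
qed

lemma hurewicz_hom: "hurewicz X \<in> hom (fundamental_group X a) (homology_group 1 X)"
proof (rule homI)
  fix u assume "u \<in> carrier (fundamental_group X a)"
  then show "hurewicz X u \<in> carrier (homology_group 1 X)"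
    by (auto simp: carrier_fundamental_group hurewicz_loop_class carrier_homology_group_1 loops_def
        simp del: One_nat_def intro!: imageI relcycle_path_simplex)
next
  fix u v assume "u \<in> carrier (fundamental_group X a)" "v \<in> carrier (fundamental_group X a)"
  then obtain p q where p: "p \<in> loops X a" "u = loop_class X a p"
    and q: "q \<in> loops X a" "v = loop_class X a q"
    by (auto simp: carrier_fundamental_group)
  have "boundary1 X (frag_of (path_simplex (loop_concat p q))
      - (frag_of (path_simplex p) + frag_of (path_simplex q)))"
    using boundary1_concat[of X p q] p q by (simp add: loops_def algebra_simps)
  then have "homology_class1 X (frag_of (path_simplex (loop_concat p q)))
      = homology_class1 X (frag_of (path_simplex p) + frag_of (path_simplex q))"
    unfolding homology_class1_eq_iff .
  then show "hurewicz X (u \<otimes>\<^bsub>fundamental_group X a\<^esub> v)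
      = hurewicz X u \<otimes>\<^bsub>homology_group 1 X\<^esub> hurewicz X v"
    using p q by (simp add: mult_fundamental_group hurewicz_loop_class loop_concat_in_loops
        mult_homology_group_1 del: One_nat_def)
qed

text \<open>Modulo boundaries concatenation is a sum and reversal a sign, so the based loop is
  \<open>p\<close> plus the path to its start minus the path to its end.\<close>

lemma boundary1_based_loop:
  assumes X: "path_connected_space X" "a \<in> topspace X" and p: "pathin X p"
  shows "boundary1 X (frag_of (path_simplex p) - frag_of (path_simplex (based_loop X a p))
    - (frag_of (path_simplex (base_path X a (p 1))) - frag_of (path_simplex (base_path X a (p 0)))))"
proof -
  note b = base_path_ends[OF X p]
  let ?u = "base_path X a (p 0)" and ?v = "base_path X a (p 1)"
  let ?r = "loop_concat p (reverse_path ?v)"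
  let ?s = "\<lambda>p. frag_of (path_simplex p)"
  have 1: "boundary1 X (?s ?r - ?s p - ?s (reverse_path ?v))"
    using b p by (intro boundary1_concat pathin_reverse_path) auto
  have 2: "boundary1 X (?s (based_loop X a p) - ?s ?u - ?s ?r)"
    unfolding based_loop_def
    using b p by (intro boundary1_concat pathin_reverse_path pathin_concat) auto
  have 3: "boundary1 X (?s ?v + ?s (reverse_path ?v))"
    using b by (intro boundary1_reverse)
  have "?s p - ?s (based_loop X a p) - (?s ?v - ?s ?u)
      = - ((?s ?r - ?s p - ?s (reverse_path ?v)) + (?s (based_loop X a p) - ?s ?u - ?s ?r)
        + (?s ?v + ?s (reverse_path ?v)))"
    by (simp add: algebra_simps)
  also have "boundary1 X \<dots>"
    unfolding singular_relboundary_minus by (intro singular_relboundary_add 1 2 3)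
  finally show ?thesis .
qed

lemma hurewicz_surj:
  assumes X: "path_connected_space X" "a \<in> topspace X"
    and G: "group (fundamental_group X a)"
  shows "hurewicz X ` carrier (fundamental_group X a) = carrier (homology_group 1 X)"
proof -
  interpret h: group_hom "fundamental_group X a" "homology_group 1 X" "hurewicz X"
    by (intro group_hom.intro group_hom_axioms.intro G hurewicz_hom group_relative_homology_group)
  \<comment> \<open>\<open>E\<close> replaces every edge by its based loop and \<open>V\<close>
    every vertex by its path from \<open>a\<close>. On an edge the error \<open>c - E c\<close> is,
    up to a boundary, \<open>V\<close> of the boundary of \<open>c\<close>.\<close>
  define E where "E = frag_extend (\<lambda>\<sigma>. frag_of (path_simplex (based_loop X a (simplex_path \<sigma>))))"
  \<comment> \<open>The argument of \<sigma> is the only point of the standard 0-simplex.\<close>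
  define V where "V = frag_extend (\<lambda>\<sigma>. frag_of (path_simplex (base_path X a (\<sigma> (\<lambda>j::nat. if j = 0 then 1 else 0 :: real)))))"
  have V_point: "V (frag_of (point_simplex x)) = frag_of (path_simplex (base_path X a x))" for x
    by (simp add: V_def point_simplex_def)
  have close: "boundary1 X (c - E c - V (chain_boundary 1 c))" if "singular_chain 1 X c" for c
    using that[unfolded singular_chain_def]
  proof (induction c rule: frag_induction)
    case (one \<sigma>)
    then have \<sigma>: "singular_simplex 1 X \<sigma>"
      by simp
    define p where "p = simplex_path \<sigma>"
    have p: "pathin X p" "\<sigma> = path_simplex p"
      using pathin_simplex_path[OF \<sigma>] path_simplex_simplex_path[OF \<sigma>] by (simp_all add: p_def)
    have "V (chain_boundary 1 (frag_of \<sigma>))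
      = frag_of (path_simplex (base_path X a (p 1))) - frag_of (path_simplex (base_path X a (p 0)))"
      unfolding p(2) chain_boundary_path_simplex
      using V_point by (simp add: V_def frag_extend_diff)
    moreover have "E (frag_of \<sigma>) = frag_of (path_simplex (based_loop X a p))"
      by (simp add: E_def p_def)
    ultimately show ?case
      using boundary1_based_loop[OF X p(1)] by (simp add: p(2) del: One_nat_def)
  next
    case (diff c d)
    have "c - d - E (c - d) - V (chain_boundary 1 (c - d))
        = (c - E c - V (chain_boundary 1 c)) - (d - E d - V (chain_boundary 1 d))"
      by (simp add: E_def V_def frag_extend_diff chain_boundary_diff algebra_simps)
    then show ?case
      using singular_relboundary_diff[OF diff] by (simp only:)
  qed (simp add: E_def V_def)
  \<comment> \<open>The image of a homomorphism is a subgroup, so it suffices that based loops are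
    hit. The induction carries along that \<open>E c\<close> is a cycle even when \<open>c\<close>
    is not, so that its class is a group element.\<close>
  have E_image: "\<exists>u\<in>carrier (fundamental_group X a). hurewicz X u = homology_class1 X (E c)
      \<and> singular_relcycle 1 X {} (E c)" if "singular_chain 1 X c" for c
    using that[unfolded singular_chain_def]
  proof (induction c rule: frag_induction)
    case zero
    show ?case
      by (rule bexI[of _ "\<one>\<^bsub>fundamental_group X a\<^esub>"])
        (auto simp: E_def one_homology_group_1 simp del: One_nat_def)
  next
    case (one \<sigma>)
    then have "based_loop X a (simplex_path \<sigma>) \<in> loops X a"
      using based_loop_in_loops[OF X pathin_simplex_path] by simp
    then show ?case
      unfolding E_def frag_extend_of
      by (intro bexI[of _ "loop_class X a (based_loop X a (simplex_path \<sigma>))"] conjI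
          hurewicz_loop_class relcycle_path_simplex)
        (auto simp: carrier_fundamental_group loops_def)
  next
    case (diff c d)
    then obtain u v where uv: "u \<in> carrier (fundamental_group X a)" "v \<in> carrier (fundamental_group X a)"
      "hurewicz X u = homology_class1 X (E c)" "hurewicz X v = homology_class1 X (E d)"
      "singular_relcycle 1 X {} (E c)" "singular_relcycle 1 X {} (E d)"
      by blast
    have E: "E (c - d) = E c - E d"
      by (simp add: E_def frag_extend_diff)
    have cyc: "singular_relcycle 1 X {} (E c - E d)"
      using uv by (intro singular_relcycle_diff)
    have mem: "homology_class1 X (E c - E d) \<in> carrier (homology_group 1 X)"
      unfolding carrier_homology_group_1 using cyc by blast
    have "homology_class1 X (E c - E d) \<otimes>\<^bsub>homology_group 1 X\<^esub> hurewicz X v = hurewicz X u"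
      unfolding uv mult_homology_group_1 by simp
    then have "homology_class1 X (E c - E d)
        = hurewicz X (u \<otimes>\<^bsub>fundamental_group X a\<^esub> inv\<^bsub>fundamental_group X a\<^esub> v)"
      using uv(1,2) h.H.inv_solve_right[of "homology_class1 X (E c - E d)" "hurewicz X u" "hurewicz X v"]
        mem by (simp del: One_nat_def)
    then show ?case
      using uv(1,2) cyc unfolding E
      by (intro bexI[of _ "u \<otimes>\<^bsub>fundamental_group X a\<^esub> inv\<^bsub>fundamental_group X a\<^esub> v"]) auto
  qed
  have "x \<in> hurewicz X ` carrier (fundamental_group X a)" if x: "x \<in> carrier (homology_group 1 X)" for x
  proof -
    obtain c where c: "x = homology_class1 X c" "singular_chain 1 X c" "chain_boundary 1 c = 0"
      using x unfolding carrier_homology_group_1 by (auto simp: singular_cycle)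
    \<comment> \<open>For a cycle the vertex term drops out, so \<open>c\<close> is homologous to
      \<open>E c\<close>.\<close>
    have "x = homology_class1 X (E c)"
      unfolding c(1) homology_class1_eq_iff using close[OF c(2)] c(3) by (simp add: V_def)
    then show ?thesis
      using E_image[OF c(2)] by auto
  qed
  then show ?thesis
    using h.hom_closed by blast
qed

section \<open>Abelianizations of wreath products\<close>

text \<open>Since types cannot be quantified over, the universal property of the abelianization is
  stated for target groups over one fixed type.\<close>

definition free_abelianization ::
  "'c itself \<Rightarrow> ('a, 'b) monoid_scheme \<Rightarrow> nat \<Rightarrow> ('a \<Rightarrow> nat \<Rightarrow> int) \<Rightarrow> bool" where
  "free_abelianization T G n \<theta> \<longleftrightarrow>
     \<theta> \<in> hom G (Z_power n) \<and> \<theta> ` carrier G = carrier (Z_power n) \<and>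
     (\<forall>(H :: 'c monoid) \<psi>. comm_group H \<longrightarrow> \<psi> \<in> hom G H \<longrightarrow>
        (\<forall>g\<in>carrier G. \<theta> g = \<one>\<^bsub>Z_power n\<^esub> \<longrightarrow> \<psi> g = \<one>\<^bsub>H\<^esub>))"

text \<open>Puts the kernel condition into coordinates: elements of \<open>Z_power n\<close> are
  extensional, so the coordinates below \<open>n\<close> decide.\<close>

lemma free_abelianizationD:
  assumes "free_abelianization (T :: 'c itself) G n \<theta>"
  shows "\<theta> \<in> hom G (Z_power n)" "\<theta> ` carrier G = carrier (Z_power n)"
    "\<And>(H :: 'c monoid) \<psi> g. \<lbrakk>comm_group H; \<psi> \<in> hom G H; g \<in> carrier G;
       \<And>j. j < n \<Longrightarrow> \<theta> g j = 0\<rbrakk> \<Longrightarrow> \<psi> g = \<one>\<^bsub>H\<^esub>"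
proof -
  show \<theta>: "\<theta> \<in> hom G (Z_power n)" "\<theta> ` carrier G = carrier (Z_power n)"
    using assms by (auto simp: free_abelianization_def)
  fix H :: "'c monoid" and \<psi> g
  assume *: "comm_group H" "\<psi> \<in> hom G H" "g \<in> carrier G" "\<And>j. j < n \<Longrightarrow> \<theta> g j = 0"
  have "\<theta> g \<in> extensional {..<n}"
    using hom_in_carrier[OF \<theta>(1) *(3)] by (auto simp: PiE_def)
  then have "\<theta> g = \<one>\<^bsub>Z_power n\<^esub>"
    using *(4) by (auto simp: fun_eq_iff extensional_def)
  then show "\<psi> g = \<one>\<^bsub>H\<^esub>"
    using assms * by (auto simp: free_abelianization_def)
qed

section \<open>Coordinates of homomorphisms into powers of the integers\<close>

lemma hom_Z_power_mult:
  assumes "\<theta> \<in> hom G (Z_power n)" "x \<in> carrier G" "y \<in> carrier G" "j < n"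
  shows "\<theta> (x \<otimes>\<^bsub>G\<^esub> y) j = \<theta> x j + \<theta> y j"
  using hom_mult[OF assms(1-3)] assms(4) by simp

lemma hom_Z_power_one:
  assumes "\<theta> \<in> hom G (Z_power n)" "group G" "j < n"
  shows "\<theta> \<one>\<^bsub>G\<^esub> j = 0"
  using hom_one[OF assms(1,2)] assms(3) by simp

lemma hom_Z_powerI:
  assumes "\<And>x. x \<in> carrier G \<Longrightarrow> \<theta> x \<in> extensional {..<n}"
    and "\<And>x y j. \<lbrakk>x \<in> carrier G; y \<in> carrier G; j < n\<rbrakk> \<Longrightarrow> \<theta> (x \<otimes>\<^bsub>G\<^esub> y) j = \<theta> x j + \<theta> y j"
    and "group G"
  shows "\<theta> \<in> hom G (Z_power n)"
proof (rule homI)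
  show "\<theta> x \<in> carrier (Z_power n)" if "x \<in> carrier G" for x
    using assms(1)[OF that] by (simp add: PiE_def)
  show "\<theta> (x \<otimes>\<^bsub>G\<^esub> y) = \<theta> x \<otimes>\<^bsub>Z_power n\<^esub> \<theta> y" if "x \<in> carrier G" "y \<in> carrier G" for x y
    using assms(1)[of "x \<otimes>\<^bsub>G\<^esub> y"] assms(2)[OF that] that group.is_monoid[OF assms(3)]
    by (auto simp: fun_eq_iff extensional_def monoid.m_closed)
qed

lemma free_abelianization_iso:
  fixes T :: "'c itself"
  assumes ab: "free_abelianization T G n \<theta>" and f: "f \<in> iso G' G" and G': "group G'"
  shows "free_abelianization T G' n (\<theta> \<circ> f)"
  unfolding free_abelianization_def
proof (intro conjI allI impI ballI)
  show "\<theta> \<circ> f \<in> hom G' (Z_power n)"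
    using f free_abelianizationD(1)[OF ab] by (auto simp: iso_def intro: hom_compose)
  have "f ` carrier G' = carrier G"
    using f by (auto simp: iso_def bij_betw_def)
  then show "(\<theta> \<circ> f) ` carrier G' = carrier (Z_power n)"
    using free_abelianizationD(2)[OF ab] by (simp only: image_comp[symmetric])
  fix H :: "'c monoid" and \<psi> g
  assume *: "comm_group H" "\<psi> \<in> hom G' H" "g \<in> carrier G'" "(\<theta> \<circ> f) g = \<one>\<^bsub>Z_power n\<^esub>"
  let ?i = "inv_into (carrier G') f"
  have "?i \<in> hom G G'"
    using group.iso_set_sym[OF G' f] by (auto simp: iso_def)
  then have "\<psi> \<circ> ?i \<in> hom G H"
    using *(2) by (auto intro: hom_compose)
  moreover have "f g \<in> carrier G"
    using f *(3) by (auto simp: iso_def bij_betw_def)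
  ultimately have "(\<psi> \<circ> ?i) (f g) = \<one>\<^bsub>H\<^esub>"
    using ab *(1,4) by (auto simp: free_abelianization_def)
  moreover have "?i (f g) = g"
    using f *(3) by (auto simp: iso_def bij_betw_def)
  ultimately show "\<psi> g = \<one>\<^bsub>H\<^esub>"
    by simp
qed

lemma free_abelianization_image_group:
  assumes "free_abelianization T G n \<theta>" "inj F" "group G"
  shows "free_abelianization T (image_group F G) n (\<theta> \<circ> Hilbert_Choice.inv F)"
  using group.inj_imp_image_group_is_group[OF assms(3) inj_on_subset[OF assms(2) subset_UNIV]]
  by (rule free_abelianization_iso[OF assms(1) inj_imp_image_group_inv_iso[OF assms(2)]])

text \<open>The only element of \<open>Z_power 0\<close> is the function that is
  \<open>undefined\<close> everywhere.\<close>

lemma free_abelianization_trivial: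
  "free_abelianization T trivial_g 0 (\<lambda>_ _. undefined)"
  by (auto simp: free_abelianization_def trivial_g_def singleton_group_def hom_def comm_group_def
      intro!: group.l_cancel_one'[THEN iffD1])

lemma free_abelianization_int:
  fixes T :: "'c itself"
  shows "free_abelianization T integer_group 1 (\<lambda>k. \<lambda>j\<in>{..<1}. k)"
  unfolding free_abelianization_def
proof (intro conjI allI impI ballI)
  show "(\<lambda>k. \<lambda>j\<in>{..<1}. k) \<in> hom integer_group (Z_power 1)"
    by (rule hom_Z_powerI) (auto split: if_splits)
  show "(\<lambda>k. \<lambda>j\<in>{..<1}. k) ` carrier integer_group = carrier (Z_power 1)"
  proof (intro equalityI subsetI)
    fix z assume "z \<in> carrier (Z_power 1)"
    then have "z = (\<lambda>j\<in>{..<1}. z 0)"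
      by (auto simp: PiE_def extensional_def fun_eq_iff)
    then show "z \<in> (\<lambda>k. \<lambda>j\<in>{..<1}. k) ` carrier integer_group"
      by simp
  qed (auto split: if_splits)
  fix H :: "'c monoid" and \<psi> g
  assume *: "comm_group H" "\<psi> \<in> hom integer_group H" "(\<lambda>j\<in>{..<1}. g) = \<one>\<^bsub>Z_power 1\<^esub>"
  have "g = 0"
    using fun_cong[OF *(3), of 0] by simp
  then show "\<psi> g = \<one>\<^bsub>H\<^esub>"
    using hom_one[of \<psi> integer_group H] * by (simp add: comm_group_def)
qed

text \<open>Every element is (x, 1) times (1, y), and \<psi> restricts to a homomorphism on each
  factor, where the given property applies.\<close>

lemma free_abelianization_DirProd:
  fixes T :: "'c itself"
  assumes G: "group G" "free_abelianization T G m \<theta>"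
    and G': "group G'" "free_abelianization T G' n \<theta>'"
  shows "free_abelianization T (G \<times>\<times> G') (m + n)
    (\<lambda>(x, y). \<lambda>j\<in>{..<m + n}. if j < m then \<theta> x j else \<theta>' y (j - m))"
    (is "free_abelianization T ?P _ ?\<theta>")
  unfolding free_abelianization_def
proof (intro conjI allI impI ballI)
  note \<theta> = free_abelianizationD[OF G(2)] and \<theta>' = free_abelianizationD[OF G'(2)]
  show "?\<theta> \<in> hom ?P (Z_power (m + n))"
  proof (rule hom_Z_powerI[OF _ _ DirProd_group[OF G(1) G'(1)]])
    show "?\<theta> x \<in> extensional {..<m + n}" for x
      by (simp add: case_prod_unfold)
    fix x y j assume xy: "x \<in> carrier ?P" "y \<in> carrier ?P" and j: "j < m + n"
    show "?\<theta> (x \<otimes>\<^bsub>?P\<^esub> y) j = ?\<theta> x j + ?\<theta> y j"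
      using xy j hom_Z_power_mult[OF \<theta>(1), of "fst x" "fst y" j]
        hom_Z_power_mult[OF \<theta>'(1), of "snd x" "snd y" "j - m"]
      by (cases x; cases y; cases "j < m") simp_all
  qed
  then have "?\<theta> ` carrier ?P \<subseteq> carrier (Z_power (m + n))"
    by (rule hom_carrier)
  moreover have "z \<in> ?\<theta> ` carrier ?P" if z: "z \<in> carrier (Z_power (m + n))" for z
  proof -
    have "(\<lambda>j\<in>{..<m}. z j) \<in> \<theta> ` carrier G" "(\<lambda>j\<in>{..<n}. z (m + j)) \<in> \<theta>' ` carrier G'"
      unfolding \<theta>(2) \<theta>'(2) by auto
    then obtain x y where xy: "x \<in> carrier G" "\<theta> x = (\<lambda>j\<in>{..<m}. z j)"
      "y \<in> carrier G'" "\<theta>' y = (\<lambda>j\<in>{..<n}. z (m + j))"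
      by (auto simp: image_iff)
    then have "?\<theta> (x, y) = z"
      using z by (auto simp: fun_eq_iff PiE_def extensional_def)
    then show ?thesis
      using xy by (intro image_eqI[of _ _ "(x, y)"]) auto
  qed
  ultimately show "?\<theta> ` carrier ?P = carrier (Z_power (m + n))"
    by blast
  fix H :: "'c monoid" and \<psi> g
  assume H: "comm_group H" and \<psi>: "\<psi> \<in> hom ?P H" and g: "g \<in> carrier ?P"
    and ker: "?\<theta> g = \<one>\<^bsub>Z_power (m + n)\<^esub>"
  obtain x y where xy: "g = (x, y)" "x \<in> carrier G" "y \<in> carrier G'"
    using g by auto
  interpret G: group G by (rule G)
  interpret G': group G' by (rule G')
  interpret H: comm_group H by (rule H)
  have coord: "?\<theta> g j = 0" if "j < m + n" for j
    using ker that by simp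
  have mult: "\<psi> (u \<otimes>\<^bsub>G\<^esub> u', v \<otimes>\<^bsub>G'\<^esub> v') = \<psi> (u, v) \<otimes>\<^bsub>H\<^esub> \<psi> (u', v')"
    if "u \<in> carrier G" "u' \<in> carrier G" "v \<in> carrier G'" "v' \<in> carrier G'" for u u' v v'
    using hom_mult[OF \<psi>, of "(u, v)" "(u', v')"] that by simp
  have "(\<lambda>u. \<psi> (u, \<one>\<^bsub>G'\<^esub>)) \<in> hom G H" "(\<lambda>v. \<psi> (\<one>\<^bsub>G\<^esub>, v)) \<in> hom G' H"
    using hom_in_carrier[OF \<psi>] mult[of _ _ "\<one>\<^bsub>G'\<^esub>" "\<one>\<^bsub>G'\<^esub>"] mult[of "\<one>\<^bsub>G\<^esub>" "\<one>\<^bsub>G\<^esub>"]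
    by (auto intro!: homI)
  moreover have "\<theta> x j = 0" if "j < m" for j
    using coord[of j] that by (simp add: xy)
  moreover have "\<theta>' y j = 0" if "j < n" for j
    using coord[of "m + j"] that by (simp add: xy)
  ultimately have "\<psi> (x, \<one>\<^bsub>G'\<^esub>) = \<one>\<^bsub>H\<^esub>" "\<psi> (\<one>\<^bsub>G\<^esub>, y) = \<one>\<^bsub>H\<^esub>"
    using \<theta>(3)[OF H _ xy(2)] \<theta>'(3)[OF H _ xy(3)] by auto
  then show "\<psi> g = \<one>\<^bsub>H\<^esub>"
    using mult[of x "\<one>\<^bsub>G\<^esub>" "\<one>\<^bsub>G'\<^esub>" y] xy by simp
qed

section \<open>Cyclic shifts and the group structure of the wreath product\<close>

lemma nat_mod_less:
  assumes "n \<ge> 1"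
  shows "nat (k mod int n) < n"
proof -
  have "k mod int n < int n"
    using assms by (intro pos_mod_bound) simp
  then show ?thesis
    using assms by linarith
qed

lemma int_nat_mod: "n \<ge> 1 \<Longrightarrow> int (nat (k mod int n)) = k mod int n"
  by (intro nat_0_le pos_mod_sign) simp

lemma cyclic_shift_in_PiE:
  assumes "n \<ge> 1" "a \<in> PiE {..<n} (\<lambda>_. S)"
  shows "cyclic_shift n k a \<in> PiE {..<n} (\<lambda>_. S)"
  unfolding cyclic_shift_def
proof (rule restrict_PiE_iff[THEN iffD2], rule ballI)
  show "a (nat ((int i + k) mod int n)) \<in> S" for i
    by (rule PiE_mem[OF assms(2)]) (simp only: lessThan_iff nat_mod_less[OF assms(1)])
qed

lemma cyclic_shift_0:
  assumes "a \<in> extensional {..<n}"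
  shows "cyclic_shift n 0 a = a"
proof
  show "cyclic_shift n 0 a i = a i" for i
    using assms by (cases "i < n") (simp_all add: cyclic_shift_def extensional_def)
qed

text \<open>Shifting permutes the indices, with the shift by \<open>-k\<close> as inverse. Hence
  sums over coordinates ignore the twist in the wreath product.\<close>

lemma sum_cyclic_shift:
  fixes f :: "'a \<Rightarrow> int"
  assumes n: "n \<ge> 1"
  shows "(\<Sum>i<n. f (cyclic_shift n k a i)) = (\<Sum>i<n. f (a i))"
proof (rule sum.reindex_bij_witness
    [where i = "\<lambda>i. nat ((int i - k) mod int n)" and j = "\<lambda>i. nat ((int i + k) mod int n)"])
  fix i assume i: "i \<in> {..<n}"
  have "((int i + k) mod int n - k) mod int n = int i" "((int i - k) mod int n + k) mod int n = int i"
    using i by (simp_all add: mod_diff_left_eq mod_add_left_eq)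
  then show "nat ((int (nat ((int i + k) mod int n)) - k) mod int n) = i"
    "nat ((int (nat ((int i - k) mod int n)) + k) mod int n) = i"
    by (simp_all only: int_nat_mod[OF n] nat_int)
  show "nat ((int i + k) mod int n) \<in> {..<n}" "nat ((int i - k) mod int n) \<in> {..<n}"
    by (simp_all only: lessThan_iff nat_mod_less[OF n])
  show "f (a (nat ((int i + k) mod int n))) = f (cyclic_shift n k a i)"
    using i by (simp add: cyclic_shift_def)
qed

lemma carrier_wreath_Z [simp]: "carrier (wreath_Z G n) = PiE {..<n} (\<lambda>_. carrier G) \<times> UNIV"
  by (simp add: wreath_Z_def semidirect_product_def)

lemma one_wreath_Z [simp]: "\<one>\<^bsub>wreath_Z G n\<^esub> = (\<lambda>i\<in>{..<n}. \<one>\<^bsub>G\<^esub>, 0)"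
  by (simp add: wreath_Z_def semidirect_product_def)

lemma mult_wreath_Z [simp]:
  "(a, h) \<otimes>\<^bsub>wreath_Z G n\<^esub> (b, k) = (\<lambda>i\<in>{..<n}. a i \<otimes>\<^bsub>G\<^esub> cyclic_shift n h b i, h + k)"
  by (simp add: wreath_Z_def semidirect_product_def)

lemma group_wreath_Z:
  assumes "group G" "n \<ge> 1"
  shows "group (wreath_Z G n)"
proof (rule groupI)
  interpret group G by (rule assms)
  note shift = cyclic_shift_in_PiE[OF assms(2)]
  have shift_mem: "cyclic_shift n k a i \<in> carrier G" if "a \<in> PiE {..<n} (\<lambda>_. carrier G)" "i < n" for a k i
    using shift[OF that(1), of k] that(2) by auto
  show "x \<otimes>\<^bsub>wreath_Z G n\<^esub> y \<in> carrier (wreath_Z G n)"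
    if xy: "x \<in> carrier (wreath_Z G n)" "y \<in> carrier (wreath_Z G n)" for x y
  proof -
    obtain a h b k where eq: "x = (a, h)" "y = (b, k)"
      by (cases x, cases y) auto
    have "a i \<otimes>\<^bsub>G\<^esub> cyclic_shift n h b i \<in> carrier G" if "i < n" for i
      using xy that by (intro m_closed shift_mem) (auto simp: eq)
    then show ?thesis
      by (simp add: eq)
  qed
  show "\<one>\<^bsub>wreath_Z G n\<^esub> \<in> carrier (wreath_Z G n)"
    by simp
  show "x \<otimes>\<^bsub>wreath_Z G n\<^esub> y \<otimes>\<^bsub>wreath_Z G n\<^esub> z = x \<otimes>\<^bsub>wreath_Z G n\<^esub> (y \<otimes>\<^bsub>wreath_Z G n\<^esub> z)"
    if xyz: "x \<in> carrier (wreath_Z G n)" "y \<in> carrier (wreath_Z G n)" "z \<in> carrier (wreath_Z G n)"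
    for x y z
  proof -
    obtain a h b k c l where eq: "x = (a, h)" "y = (b, k)" "z = (c, l)"
      by (cases x, cases y, cases z) auto
    \<comment> \<open>Shifting respects products of tuples, and successive shifts add up modulo
      \<open>n\<close>.\<close>
    have *: "cyclic_shift n h (\<lambda>i\<in>{..<n}. b i \<otimes>\<^bsub>G\<^esub> cyclic_shift n k c i) i
        = cyclic_shift n h b i \<otimes>\<^bsub>G\<^esub> cyclic_shift n (h + k) c i" if "i < n" for i
      using that nat_mod_less[OF assms(2)]
      by (simp add: cyclic_shift_def mod_add_left_eq add.assoc int_nat_mod[OF assms(2)])
    have "a i \<otimes>\<^bsub>G\<^esub> cyclic_shift n h b i \<otimes>\<^bsub>G\<^esub> cyclic_shift n (h + k) c i
        = a i \<otimes>\<^bsub>G\<^esub> (cyclic_shift n h b i \<otimes>\<^bsub>G\<^esub> cyclic_shift n (h + k) c i)" if "i < n" for i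
      using xyz that by (intro m_assoc shift_mem) (auto simp: eq)
    then show ?thesis
      unfolding eq mult_wreath_Z by (simp add: * cong: restrict_cong)
  qed
  show "\<one>\<^bsub>wreath_Z G n\<^esub> \<otimes>\<^bsub>wreath_Z G n\<^esub> x = x" if "x \<in> carrier (wreath_Z G n)" for x
    using that by (cases x) (auto simp: cyclic_shift_0 PiE_def Pi_iff extensional_def fun_eq_iff)
  show "\<exists>y\<in>carrier (wreath_Z G n). y \<otimes>\<^bsub>wreath_Z G n\<^esub> x = \<one>\<^bsub>wreath_Z G n\<^esub>"
    if x: "x \<in> carrier (wreath_Z G n)" for x
  proof -
    obtain a h where eq: "x = (a, h)" and a: "a \<in> PiE {..<n} (\<lambda>_. carrier G)"
      using x by auto
    \<comment> \<open>A left factor (b, -h) turns (a, h) into b times the shift of \<open>a\<close>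
      by \<open>-h\<close>, which dictates b.\<close>
    show ?thesis
      using shift_mem[OF a]
      by (intro bexI[of _ "(\<lambda>i\<in>{..<n}. inv\<^bsub>G\<^esub> (cyclic_shift n (- h) a i), - h)"])
        (auto simp: eq fun_eq_iff)
  qed
qed

text \<open>Summing over the coordinates is additive because it ignores shifts. For the kernel, all
  entries are collected at place 0, where \<psi> is a homomorphism on \<open>G\<close>.\<close>

lemma free_abelianization_wreath_Z:
  fixes T :: "'c itself"
  assumes G: "group G" and ab: "free_abelianization T G m \<theta>" and n: "n \<ge> 1"
  shows "free_abelianization T (wreath_Z G n) (m + 1)
    (\<lambda>(a, k). \<lambda>j\<in>{..<m + 1}. if j < m then \<Sum>i<n. \<theta> (a i) j else k)"
    (is "free_abelianization T ?W _ ?\<theta>")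
  unfolding free_abelianization_def
proof (intro conjI allI impI ballI)
  note \<theta> = free_abelianizationD[OF ab]
  note shift = cyclic_shift_in_PiE[OF n]
  interpret G: group G by (rule G)
  have shift_mem: "cyclic_shift n k a i \<in> carrier G" if "a \<in> PiE {..<n} (\<lambda>_. carrier G)" "i < n" for a k i
    using shift[OF that(1), of k] that(2) by auto
  have \<theta>_mult: "\<theta> (x \<otimes>\<^bsub>G\<^esub> y) j = \<theta> x j + \<theta> y j"
    if "x \<in> carrier G" "y \<in> carrier G" "j < m" for x y j
    using that by (rule hom_Z_power_mult[OF \<theta>(1)])
  have \<theta>_one: "\<theta> \<one>\<^bsub>G\<^esub> j = 0" if "j < m" for j
    using that by (rule hom_Z_power_one[OF \<theta>(1) G])
  \<comment> \<open>The embedding of \<open>G\<close> as the \<open>i\<close>-th factor.\<close>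
  define e where "e i x = (\<lambda>j\<in>{..<n}. if j = i then x else \<one>\<^bsub>G\<^esub>)" for i x
  have e: "e i x \<in> PiE {..<n} (\<lambda>_. carrier G)" if "x \<in> carrier G" for i x
    using that by (auto simp: e_def)
  show "?\<theta> \<in> hom ?W (Z_power (m + 1))"
  proof (rule hom_Z_powerI[OF _ _ group_wreath_Z[OF G n]])
    fix x y j assume xy: "x \<in> carrier ?W" "y \<in> carrier ?W" and j: "j < m + 1"
    obtain a h b k where eq: "x = (a, h)" "y = (b, k)"
      by (cases x, cases y) auto
    show "?\<theta> (x \<otimes>\<^bsub>?W\<^esub> y) j = ?\<theta> x j + ?\<theta> y j"
    proof (cases "j < m")
      case True
      have "(\<Sum>i<n. \<theta> (a i \<otimes>\<^bsub>G\<^esub> cyclic_shift n h b i) j)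
          = (\<Sum>i<n. \<theta> (a i) j + \<theta> (cyclic_shift n h b i) j)"
        using xy True by (intro sum.cong refl \<theta>_mult) (auto simp: eq shift_mem)
      then show ?thesis
        using True sum_cyclic_shift[OF n, of "\<lambda>x. \<theta> x j" h b] by (simp add: eq sum.distrib)
    qed (use j in \<open>simp add: eq\<close>)
  qed auto
  then have "?\<theta> ` carrier ?W \<subseteq> carrier (Z_power (m + 1))"
    by (rule hom_carrier)
  moreover have "z \<in> ?\<theta> ` carrier ?W" if z: "z \<in> carrier (Z_power (m + 1))" for z
  proof -
    have "(\<lambda>j\<in>{..<m}. z j) \<in> \<theta> ` carrier G"
      unfolding \<theta>(2) by auto
    then obtain x where x: "x \<in> carrier G" "\<theta> x = (\<lambda>j\<in>{..<m}. z j)"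
      by auto
    \<comment> \<open>Place 0 exists because \<open>n\<close> is at least 1; the other entries are
      units and contribute 0.\<close>
    have "(\<Sum>i<n. \<theta> (e 0 x i) j) = z j" if "j < m" for j
    proof -
      have "(\<Sum>i<n. \<theta> (e 0 x i) j) = (\<Sum>i<n. if i = 0 then \<theta> x j else 0)"
        using that by (intro sum.cong refl) (simp add: e_def \<theta>_one)
      then show ?thesis
        using n that x(2) by simp
    qed
    then have "?\<theta> (e 0 x, z m) = z"
      using z by (auto simp: fun_eq_iff PiE_def extensional_def less_Suc_eq)
    then show ?thesis
      using e[OF x(1)] by (intro image_eqI[of _ _ "(e 0 x, z m)"]) auto
  qed
  ultimately show "?\<theta> ` carrier ?W = carrier (Z_power (m + 1))"
    by blast
  fix H :: "'c monoid" and \<psi> g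
  assume H: "comm_group H" and \<psi>: "\<psi> \<in> hom ?W H" and g: "g \<in> carrier ?W"
    and ker: "?\<theta> g = \<one>\<^bsub>Z_power (m + 1)\<^esub>"
  interpret H: comm_group H by (rule H)
  have mult: "\<psi> (u \<otimes>\<^bsub>?W\<^esub> v) = \<psi> u \<otimes>\<^bsub>H\<^esub> \<psi> v" if "u \<in> carrier ?W" "v \<in> carrier ?W" for u v
    using hom_mult[OF \<psi> that] .
  have closed: "\<psi> u \<in> carrier H" if "u \<in> carrier ?W" for u
    using hom_in_carrier[OF \<psi> that] .
  have eq0: "(a, 0) \<otimes>\<^bsub>?W\<^esub> (b, 0) = (\<lambda>i\<in>{..<n}. a i \<otimes>\<^bsub>G\<^esub> b i, 0)"
    if "b \<in> PiE {..<n} (\<lambda>_. carrier G)" for a b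
    using that by (simp add: cyclic_shift_0 PiE_def)
  \<comment> \<open>Conjugation by the generator of \<open>\<int>\<close> permutes the factors, so all of them have the same image.\<close>
  have conj: "\<psi> (e l x, 0) = \<psi> (e 0 x, 0)" if x: "x \<in> carrier G" and l: "l < n" for l x
  proof -
    \<comment> \<open>\<open>cyclic_shift\<close> reads entry i + k at place i, so moving place 0 to
      place \<open>l\<close> needs k = -l.\<close>
    let ?s = "(\<lambda>i\<in>{..<n}. \<one>\<^bsub>G\<^esub>, - int l)"
    have "nat ((int i + - int l) mod int n) = 0 \<longleftrightarrow> i = l" if "i < n" for i
    proof -
      have "(int i + - int l) mod int n = 0 \<longleftrightarrow> int i mod int n = int l mod int n"
        by (simp add: mod_eq_dvd_iff dvd_eq_mod_eq_0)
      then have "(int i + - int l) mod int n = 0 \<longleftrightarrow> i = l"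
        using that l by simp
      moreover have "0 \<le> (int i + - int l) mod int n"
        using n by (intro pos_mod_sign) simp
      ultimately show ?thesis
        by linarith
    qed
    then have shift_e: "cyclic_shift n (- int l) (e 0 x) = e l x"
      unfolding cyclic_shift_def e_def
      by (intro restrict_ext) (simp only: restrict_apply lessThan_iff nat_mod_less[OF n] if_True)
    have "?s \<otimes>\<^bsub>?W\<^esub> (e 0 x, 0) = (e l x, 0) \<otimes>\<^bsub>?W\<^esub> ?s"
      using PiE_mem[OF e[OF x, of l]] by (simp add: shift_e cyclic_shift_0 cong: restrict_cong)
    then have "\<psi> ?s \<otimes>\<^bsub>H\<^esub> \<psi> (e 0 x, 0) = \<psi> (e l x, 0) \<otimes>\<^bsub>H\<^esub> \<psi> ?s"
      using mult[of ?s "(e 0 x, 0)"] mult[of "(e l x, 0)" ?s] e[OF x] by auto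
    then show ?thesis
      using closed[of ?s] closed[of "(e 0 x, 0)"] closed[of "(e l x, 0)"] e[OF x]
      by (simp add: H.m_comm[of "\<psi> ?s"])
  qed
  have e0_mult: "\<psi> (e 0 (x \<otimes>\<^bsub>G\<^esub> y), 0) = \<psi> (e 0 x, 0) \<otimes>\<^bsub>H\<^esub> \<psi> (e 0 y, 0)"
    if "x \<in> carrier G" "y \<in> carrier G" for x y
  proof -
    have "(e 0 (x \<otimes>\<^bsub>G\<^esub> y), 0) = (e 0 x, 0) \<otimes>\<^bsub>?W\<^esub> (e 0 y, 0)"
      unfolding eq0[OF e[OF that(2)]] using that by (auto simp: e_def fun_eq_iff)
    then show ?thesis
      using mult[of "(e 0 x, 0)" "(e 0 y, 0)"] e that by auto
  qed
  have e0_hom: "(\<lambda>x. \<psi> (e 0 x, 0)) \<in> hom G H"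
    using e0_mult closed e by (auto intro!: homI)
  obtain a k where ak: "g = (a, k)" "a \<in> PiE {..<n} (\<lambda>_. carrier G)"
    using g by auto
  have coord: "?\<theta> g j = 0" if "j < m + 1" for j
    using ker that by simp
  have k: "k = 0"
    using coord[of m] by (simp add: ak)
  have sum0: "(\<Sum>i<n. \<theta> (a i) j) = 0" if "j < m" for j
    using coord[of j] that by (simp add: ak)
  \<comment> \<open>Truncations let the entries of \<open>a\<close> be moved to place 0 one at a
    time.\<close>
  define trunc where "trunc l = (\<lambda>i\<in>{..<n}. if i < l then a i else \<one>\<^bsub>G\<^esub>)" for l
  have trunc: "trunc l \<in> PiE {..<n} (\<lambda>_. carrier G)" for l
    using PiE_mem[OF ak(2)] by (simp add: trunc_def)
  \<comment> \<open>The witness is the product of the first \<open>l\<close> entries: moved to place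
    0 they multiply in \<open>G\<close>, and \<theta> turns the product into the sum.\<close>
  have "\<exists>x\<in>carrier G. \<psi> (trunc l, 0) = \<psi> (e 0 x, 0) \<and> (\<forall>j<m. (\<Sum>i<l. \<theta> (a i) j) = \<theta> x j)"
    if "l \<le> n" for l
    using that
  proof (induction l)
    case 0
    have "trunc 0 = e 0 \<one>\<^bsub>G\<^esub>"
      by (auto simp: trunc_def e_def)
    then show ?case
      by (intro bexI[of _ "\<one>\<^bsub>G\<^esub>"]) (auto simp: \<theta>_one)
  next
    case (Suc l)
    then obtain x where x: "x \<in> carrier G" "\<psi> (trunc l, 0) = \<psi> (e 0 x, 0)"
      "\<And>j. j < m \<Longrightarrow> (\<Sum>i<l. \<theta> (a i) j) = \<theta> x j"
      by auto
    have l: "l < n"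
      using Suc.prems by simp
    then have al: "a l \<in> carrier G"
      using PiE_mem[OF ak(2)] by simp
    have "(trunc (Suc l), 0) = (trunc l, 0) \<otimes>\<^bsub>?W\<^esub> (e l (a l), 0)"
      unfolding eq0[OF e[OF al]] using PiE_mem[OF ak(2)] l
      by (auto simp: trunc_def e_def fun_eq_iff less_Suc_eq)
    then have "\<psi> (trunc (Suc l), 0) = \<psi> (trunc l, 0) \<otimes>\<^bsub>H\<^esub> \<psi> (e l (a l), 0)"
      using mult[of "(trunc l, 0)" "(e l (a l), 0)"] trunc[of l] e[OF al] by auto
    also have "\<dots> = \<psi> (e 0 (x \<otimes>\<^bsub>G\<^esub> a l), 0)"
      unfolding x(2) conj[OF al l] e0_mult[OF x(1) al] ..
    finally show ?case
      using x(1,3) al \<theta>_mult[OF x(1) al]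
      by (intro bexI[of _ "x \<otimes>\<^bsub>G\<^esub> a l"] conjI allI impI) simp_all
  qed
  from this[of n] obtain x where x: "x \<in> carrier G" "\<psi> (trunc n, 0) = \<psi> (e 0 x, 0)"
      "\<And>j. j < m \<Longrightarrow> (\<Sum>i<n. \<theta> (a i) j) = \<theta> x j"
    by auto
  have "trunc n = a"
    using ak(2) by (auto simp: trunc_def fun_eq_iff PiE_def extensional_def)
  then have "\<psi> g = \<psi> (e 0 x, 0)"
    using x(2) k by (simp add: ak)
  \<comment> \<open>All coordinates of \<theta> vanish at the collected product \<open>x\<close>, so
    the property of \<open>G\<close> applies.\<close>
  also have "\<dots> = \<one>\<^bsub>H\<^esub>"
    using \<theta>(3)[OF H e0_hom x(1)] x(3) sum0 by simp
  finally show "\<psi> g = \<one>\<^bsub>H\<^esub>" .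
qed

text \<open>The group property travels through the induction because each construction step assumes
  it of its constituents.\<close>

lemma free_abelianization_word_group:
  assumes "wf_gword \<omega>"
  shows "group (word_group \<omega>) \<and> (\<exists>\<theta>. free_abelianization (T :: 'c itself) (word_group \<omega>) (beta1 \<omega>) \<theta>)"
  using assms
proof (induction \<omega>)
  case W1
  show ?case
    unfolding word_group.simps beta1.simps using free_abelianization_trivial[of T]
    by (auto simp: trivial_g_def)
next
  case WZ
  have F: "inj GInt"
    by (simp add: inj_def)
  show ?case
    unfolding word_group.simps beta1.simps int_g_def
    using group.inj_imp_image_group_is_group[OF group_integer_group inj_on_subset[OF F subset_UNIV]]
      free_abelianization_image_group[OF free_abelianization_int[of T] F group_integer_group]
    by blast
next
  case (WTimes \<alpha> \<beta>)
  then obtain \<theta> \<theta>' where *: "group (word_group \<alpha>)" "free_abelianization T (word_group \<alpha>) (beta1 \<alpha>) \<theta>"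
    "group (word_group \<beta>)" "free_abelianization T (word_group \<beta>) (beta1 \<beta>) \<theta>'"
    by auto
  have F: "inj (\<lambda>(a, b). GPair a b)"
    by (auto simp: inj_def)
  note P = DirProd_group[OF *(1,3)]
  show ?case
    unfolding word_group.simps beta1.simps times_g_def
    using group.inj_imp_image_group_is_group[OF P inj_on_subset[OF F subset_UNIV]]
      free_abelianization_image_group[OF free_abelianization_DirProd[OF *] F P]
    by blast
next
  case (WWreath \<alpha> n)
  then obtain \<theta> where *: "group (word_group \<alpha>)" "free_abelianization T (word_group \<alpha>) (beta1 \<alpha>) \<theta>"
    and n: "n \<ge> 1"
    by auto
  have F: "inj (\<lambda>(a, k). GWreath a k)"
    by (auto simp: inj_def)
  note W = group_wreath_Z[OF *(1) n]
  show ?case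
    unfolding word_group.simps beta1.simps wreath_g_def
    using group.inj_imp_image_group_is_group[OF W inj_on_subset[OF F subset_UNIV]]
      free_abelianization_image_group[OF free_abelianization_wreath_Z[OF * n] F W]
    by blast
qed

section \<open>Ranks\<close>

text \<open>Elimination: pick a vector with nonzero last coordinate and use it to clear that
  coordinate in all the others.\<close>

lemma integer_vectors_dependent:
  fixes v :: "'a \<Rightarrow> nat \<Rightarrow> int"
  assumes "finite S" "n < card S"
  shows "\<exists>k. (\<exists>s\<in>S. k s \<noteq> 0) \<and> (\<forall>j<n. (\<Sum>s\<in>S. k s * v s j) = 0)"
  using assms
proof (induction n arbitrary: S v)
  case 0
  then obtain s where "s \<in> S"
    by fastforce
  then show ?case
    by (intro exI[of _ "\<lambda>_. 1"]) auto
next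
  case (Suc n)
  show ?case
  proof (cases "\<forall>s\<in>S. v s n = 0")
    case True
    obtain k where k: "\<exists>s\<in>S. k s \<noteq> 0" "\<forall>j<n. (\<Sum>s\<in>S. k s * v s j) = 0"
      using Suc.IH[of S v] Suc.prems by auto
    then show ?thesis
      using True by (intro exI[of _ k]) (auto simp: less_Suc_eq)
  next
    case False
    then obtain s0 where s0: "s0 \<in> S" "v s0 n \<noteq> 0"
      by auto
    define c where "c = v s0 n"
    have "n < card (S - {s0})"
      using Suc.prems s0(1) by (simp add: less_diff_conv)
    then obtain k where k: "\<exists>s\<in>S - {s0}. k s \<noteq> 0"
      "\<And>j. j < n \<Longrightarrow> (\<Sum>s\<in>S - {s0}. k s * (c * v s j - v s n * v s0 j)) = 0"
      using Suc.IH[of "S - {s0}" "\<lambda>s j. c * v s j - v s n * v s0 j"] Suc.prems(1) by auto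
    \<comment> \<open>The coefficient of \<open>s0\<close> is forced: it makes the combination of
      the original vectors equal to that of the cleared ones.\<close>
    define k' where "k' s = (if s = s0 then - (\<Sum>s\<in>S - {s0}. k s * v s n) else c * k s)" for s
    have "(\<Sum>s\<in>S. k' s * v s j) = (\<Sum>s\<in>S - {s0}. k s * (c * v s j - v s n * v s0 j))" for j
    proof -
      have "(\<Sum>s\<in>S. k' s * v s j) = k' s0 * v s0 j + (\<Sum>s\<in>S - {s0}. k' s * v s j)"
        using Suc.prems(1) s0 by (simp add: sum.remove)
      also have "(\<Sum>s\<in>S - {s0}. k' s * v s j) = (\<Sum>s\<in>S - {s0}. c * k s * v s j)"
        by (intro sum.cong) (auto simp: k'_def)
      also have "k' s0 * v s0 j = - (\<Sum>s\<in>S - {s0}. k s * (v s n * v s0 j))"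
        by (simp add: k'_def sum_distrib_right mult.assoc)
      finally show ?thesis
        by (simp add: right_diff_distrib sum_subtractf mult_ac)
    qed
    \<comment> \<open>Coordinate \<open>n\<close> of the cleared vectors is zero term by
      term.\<close>
    moreover have "(\<Sum>s\<in>S - {s0}. k s * (c * v s n - v s n * v s0 n)) = 0"
      by (simp add: c_def)
    ultimately have "\<forall>j<Suc n. (\<Sum>s\<in>S. k' s * v s j) = 0"
      using k(2) by (auto simp: less_Suc_eq)
    moreover have "\<exists>s\<in>S. k' s \<noteq> 0"
      using k(1) s0(2) by (auto simp: k'_def c_def)
    ultimately show ?thesis
      by blast
  qed
qed

lemma hom_Z_power_finprod:
  assumes "comm_group G" "f \<in> hom G (Z_power n)" "finite S" "S \<subseteq> carrier G" "j < n"
  shows "f (finprod G (\<lambda>x. x [^]\<^bsub>G\<^esub> (k x :: int)) S) j = (\<Sum>x\<in>S. k x * f x j)"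
  using assms(3,4)
proof (induction S rule: finite_induct)
  interpret G: comm_group G by (rule assms)
  {
    case empty
    then show ?case
      using hom_Z_power_one[OF assms(2) _ assms(5)] by simp
  next
    case (insert x S)
    have t: "(\<lambda>x. f x j) \<in> hom G integer_group"
      using hom_Z_power_mult[OF assms(2) _ _ assms(5)] by (auto intro!: homI)
    have "f (x [^]\<^bsub>G\<^esub> k x) j = k x * f x j"
      using group_hom.hom_int_pow[of G integer_group "\<lambda>x. f x j" x "k x"] t insert.prems
      by (simp add: group_hom_def group_hom_axioms_def)
    moreover have "(\<lambda>x. x [^]\<^bsub>G\<^esub> k x) \<in> S \<rightarrow> carrier G"
      using insert.prems by auto
    ultimately show ?case
      using insert by (simp add: hom_Z_power_mult[OF assms(2) _ _ assms(5)])
  }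
qed

text \<open>Moves independence to integer vectors, where elimination applies.\<close>

lemma Z_independent_iff:
  assumes G: "comm_group G" and f: "f \<in> iso G (Z_power n)"
  shows "Z_independent G S \<longleftrightarrow> finite S \<and> S \<subseteq> carrier G \<and>
    (\<forall>k :: 'a \<Rightarrow> int. (\<forall>j<n. (\<Sum>x\<in>S. k x * f x j) = 0) \<longrightarrow> (\<forall>x\<in>S. k x = 0))"
proof -
  interpret G: comm_group G by (rule G)
  have hom: "f \<in> hom G (Z_power n)" and inj: "inj_on f (carrier G)"
    using f by (auto simp: iso_def bij_betw_def)
  have "finprod G (\<lambda>x. x [^]\<^bsub>G\<^esub> k x) S = \<one>\<^bsub>G\<^esub> \<longleftrightarrow> (\<forall>j<n. (\<Sum>x\<in>S. k x * f x j) = 0)"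
    if S: "finite S" "S \<subseteq> carrier G" for k :: "'a \<Rightarrow> int"
  proof -
    let ?p = "finprod G (\<lambda>x. x [^]\<^bsub>G\<^esub> k x) S"
    have p: "?p \<in> carrier G"
      using S by (intro G.finprod_closed) auto
    then have "?p = \<one>\<^bsub>G\<^esub> \<longleftrightarrow> f ?p = f \<one>\<^bsub>G\<^esub>"
      using inj by (auto simp: inj_on_def)
    also have "\<dots> \<longleftrightarrow> (\<forall>j<n. f ?p j = f \<one>\<^bsub>G\<^esub> j)"
      using hom_in_carrier[OF hom p] hom_in_carrier[OF hom G.one_closed]
      by (auto simp: PiE_def intro: extensionalityI)
    also have "\<dots> \<longleftrightarrow> (\<forall>j<n. (\<Sum>x\<in>S. k x * f x j) = 0)"
      using hom_Z_power_finprod[OF G hom S] hom_Z_power_one[OF hom G.is_group] by simp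
    finally show ?thesis .
  qed
  then show ?thesis
    unfolding Z_independent_def by blast
qed

text \<open>Preimages of the unit vectors attain the supremum; by elimination, more than
  \<open>n\<close> elements are dependent.\<close>

lemma abelian_rank_eq:
  assumes G: "comm_group G" and iso: "G \<cong> Z_power n"
  shows "abelian_rank G = enat n"
proof -
  obtain f where f: "f \<in> iso G (Z_power n)"
    using iso by (auto simp: is_iso_def)
  note indep = Z_independent_iff[OF G f]
  define \<delta> where "\<delta> i = (\<lambda>j\<in>{..<n}. if j = i then 1 else 0 :: int)" for i
  define b where "b i = inv_into (carrier G) f (\<delta> i)" for i
  have "\<delta> i \<in> f ` carrier G" for i
    using f by (auto simp: iso_def bij_betw_def \<delta>_def)
  then have b: "b i \<in> carrier G" "f (b i) = \<delta> i" for i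
    by (auto simp: b_def inv_into_into f_inv_into_f)
  have inj: "inj_on b {..<n}"
  proof (rule inj_onI)
    fix i j assume "i \<in> {..<n}" "b i = b j"
    then have "\<delta> i i = \<delta> j i"
      using b(2) by metis
    then show "i = j"
      using \<open>i \<in> {..<n}\<close> by (simp add: \<delta>_def split: if_splits)
  qed
  have "Z_independent G (b ` {..<n})"
    unfolding indep
  proof (intro conjI allI impI ballI)
    fix k :: "'a \<Rightarrow> int" and x
    assume k: "\<forall>j<n. (\<Sum>x\<in>b ` {..<n}. k x * f x j) = 0" and "x \<in> b ` {..<n}"
    then obtain i where i: "i < n" "x = b i"
      by auto
    have "(\<Sum>x\<in>b ` {..<n}. k x * f x i) = (\<Sum>l<n. k (b l) * \<delta> l i)"
      by (simp add: sum.reindex[OF inj] b)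
    also have "\<dots> = (\<Sum>l<n. if l = i then k (b i) else 0)"
      using i by (intro sum.cong) (auto simp: \<delta>_def)
    finally show "k x = 0"
      using k i by simp
  qed (use b in auto)
  moreover have "card (b ` {..<n}) = n"
    using card_image[OF inj] by simp
  moreover have "card S \<le> n" if "Z_independent G S" for S
  proof (rule ccontr)
    assume "\<not> card S \<le> n"
    then show False
      using integer_vectors_dependent[of S n f] that unfolding indep by auto
  qed
  ultimately show ?thesis
    unfolding abelian_rank_def
    by (intro antisym SUP_least SUP_upper2[of "b ` {..<n}"]) auto
qed

section \<open>First homology from the abelianized fundamental group\<close>

text \<open>The target type in \<open>free_abelianization\<close> is that of homology classes
  because its \<psi> is going to be the Hurewicz map.\<close>

lemma homology_group_1_iso:
  fixes X :: "'a topology"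
  assumes X: "path_connected_space X" "a \<in> topspace X"
    and G: "group (fundamental_group X a)"
    and ab: "free_abelianization TYPE('a chain set) (fundamental_group X a) n \<theta>"
  shows "homology_group 1 X \<cong> Z_power n"
proof -
  let ?G = "fundamental_group X a" and ?H = "homology_group 1 X"
  note \<theta> = free_abelianizationD[OF ab]
  have Z: "group (Z_power n)"
    by simp
  have H: "comm_group ?H"
    by (rule abelian_relative_homology_group)
  interpret h: group_hom ?G ?H "hurewicz X"
    by (intro group_hom.intro group_hom_axioms.intro G hurewicz_hom group_relative_homology_group)
  interpret t: group_hom ?G "Z_power n" \<theta>
    by (intro group_hom.intro group_hom_axioms.intro G Z \<theta>(1))
  \<comment> \<open>From right to left this is the defining property of \<theta>, as homology is
    commutative; from left to right it uses the cocycle of each coordinate of \<theta>.\<close>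
  have "hurewicz X u = \<one>\<^bsub>?H\<^esub> \<longleftrightarrow> \<theta> u = \<one>\<^bsub>Z_power n\<^esub>" if u: "u \<in> carrier ?G" for u
  proof
    assume "\<theta> u = \<one>\<^bsub>Z_power n\<^esub>"
    then show "hurewicz X u = \<one>\<^bsub>?H\<^esub>"
      using \<theta>(3)[OF H hurewicz_hom u] by simp
  next
    assume *: "hurewicz X u = \<one>\<^bsub>?H\<^esub>"
    obtain p where p: "p \<in> loops X a" "u = loop_class X a p"
      using u by (auto simp: carrier_fundamental_group)
    have "boundary1 X (frag_of (path_simplex p) - 0)"
      using * unfolding p(2) hurewicz_loop_class[OF p(1)] one_homology_group_1 homology_class1_eq_iff .
    then have bd: "boundary1 X (frag_of (path_simplex p))"
      by simp
    have "\<theta> u j = 0" if j: "j < n" for j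
    proof -
      have "(\<lambda>u. \<theta> u j) \<in> hom ?G integer_group"
        using hom_Z_power_mult[OF \<theta>(1) _ _ j] by (auto intro!: homI)
      from hom_eq_zero_if_boundary[OF X G this p(1) bd] show ?thesis
        by (simp add: p(2))
    qed
    moreover have "\<theta> u \<in> extensional {..<n}"
      using hom_in_carrier[OF \<theta>(1) u] by (simp add: PiE_def)
    ultimately show "\<theta> u = \<one>\<^bsub>Z_power n\<^esub>"
      by (auto simp: fun_eq_iff extensional_def)
  qed
  then have ker: "kernel ?G ?H (hurewicz X) = kernel ?G (Z_power n) \<theta>"
    by (auto simp: kernel_def)
  \<comment> \<open>The first isomorphism theorem for both maps, with their common kernel.\<close>
  have "?G Mod kernel ?G ?H (hurewicz X) \<cong> ?H"
    by (rule h.FactGroup_iso[OF hurewicz_surj[OF X G]])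
  moreover have "?G Mod kernel ?G (Z_power n) \<theta> \<cong> Z_power n"
    by (rule t.FactGroup_iso[OF \<theta>(2)])
  moreover have "group (?G Mod kernel ?G ?H (hurewicz X))"
    by (intro normal.factorgroup_is_group h.normal_kernel)
  ultimately show ?thesis
    unfolding ker using group.iso_sym iso_trans by blast
qed

theorem corollary1p4:
  fixes M :: "'m topology" and A :: "'m chart set"
    and P :: "complex set" and f :: "'m \<Rightarrow> complex" and \<omega> :: gword
  assumes "compact_connected_oriented_surface M A"
    and "\<not> M homeomorphic_space sphere2"
    and "\<not> M homeomorphic_space torus2"
    and "P = \<real> \<or> P = sphere 0 1"
    and "morse M A P f"
    and "class_G (fundamental_group (orbit_component M A P f) f)"
    and "presentation_of \<omega> (fundamental_group (orbit_component M A P f) f)"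
  shows "homology_group 1 (orbit_component M A P f) \<cong> Z_power (beta1 \<omega>)
       \<and> betti_number 1 (orbit_component M A P f) = enat (beta1 \<omega>)"
proof -
  let ?X = "orbit_component M A P f"
  let ?G = "fundamental_group ?X f"
  have G: "group ?G"
    using assms(6) by (simp add: class_G_def)
  \<comment> \<open>The group has a unit, so some loop at \<open>f\<close> exists, and this puts
    \<open>f\<close> into the space.\<close>
  then obtain p where "p \<in> loops ?X f"
    using carrier_fundamental_group[of ?X f] monoid.one_closed[OF group.is_monoid[OF G]] by auto
  then have base: "f \<in> topspace ?X"
    using path_start_in_topspace[of ?X p] by (auto simp: loops_def)
  have connected: "path_connected_space ?X"
    using path_connectedin_path_component_of[of "orbit_space M A P f" f]
    by (simp add: orbit_component_def path_connectedin_def)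
  have \<omega>: "wf_gword \<omega>" "word_group \<omega> \<cong> ?G"
    using assms(7) by (simp_all add: presentation_of_def)
  obtain \<theta> where W: "group (word_group \<omega>)"
    and \<theta>: "free_abelianization TYPE(('m \<Rightarrow> complex) chain set) (word_group \<omega>) (beta1 \<omega>) \<theta>"
    using free_abelianization_word_group[OF \<omega>(1)] by blast
  obtain g where "g \<in> iso ?G (word_group \<omega>)"
    using group.iso_sym[OF W \<omega>(2)] by (auto simp: is_iso_def)
  from free_abelianization_iso[OF \<theta> this G]
  have iso: "homology_group 1 ?X \<cong> Z_power (beta1 \<omega>)"
    by (rule homology_group_1_iso[OF connected base G])
  then have "betti_number 1 ?X = enat (beta1 \<omega>)"
    unfolding betti_number_def by (intro abelian_rank_eq abelian_relative_homology_group)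
  with iso show ?thesis
    by simp
qed

end
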